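(* Let $F_{\mathrm{asym}}:\mathbb{R}^{d_1\times r}\times\mathbb{R}^{d_2\times r}\to\mathbb{R}^{d_1\times d_2}$, $F_{\mathrm{asym}}(X,Y)=XY^\top$. Then $\|\nabla F_{\mathrm{asym}}(X,Y)-\nabla F_{\mathrm{asym}}(\tilde X,\tilde Y)\|_{\mathrm{op}}\le\sqrt2\,\|(X,Y)-(\tilde X,\tilde Y)\|_F$ for all $(X,Y),(\tilde X,\tilde Y)$. Moreover, let $Z^\star\in\mathbb{R}^{d_1\times d_2}$ have rank $r^\star\ge1$ and let $Z^\star=X^\star(Y^\star)^\top$ be any factorization, with $X^\star\in\mathbb{R}^{d_1\times r}$, $Y^\star\in\mathbb{R}^{d_2\times r}$, such that $\operatorname{rank}(X^\star)=\operatorname{rank}(Y^\star)=r^\star$ and the right singular vectors of the two factors match, $V^{X^\star}=V^{Y^\star}$. Then $F_{\mathrm{asym}}$ is locally weakly aligned at $(X^\star,Y^\star)$ with radius $$\varepsilon_{x^\star}=\frac{1}{16\sqrt2}\,\frac{\min\{\sigma_{r^\star}^2(X^\star),\sigma_{r^\star}^2(Y^\star)\}}{\max\{\sigma_1(X^\star),\sigma_1(Y^\star)\}}$$ and functions $$s(\rho)=\frac{\rho}{10\sqrt2\,(r-r^\star+1)^2}\,\frac{\min\{\sigma_{r^\star}^2(X^\star),\sigma_{r^\star}^2(Y^\star)\}}{\sigma_{r^\star}^2(X^\star)+\sigma_{r^\star}^2(Y^\star)},\qquad\delta(\rho)=\min\left\{\frac{\rho}{4},\frac{1}{4s(\rh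o)}\right\}\min\{\sigma_{r^\star}^2(X^\star),\sigma_{r^\star}^2(Y^\star)\}.$$
   Context: Matrix spaces carry the Frobenius norm, and $\|(X,Y)\|_F^2=\|X\|_F^2+\|Y\|_F^2$. $\sigma_i(\cdot)$ is the $i$-th largest singular value. $V^{X^\star}=V^{Y^\star}$ means that $X^\star$ and $Y^\star$ admit (full) singular value decompositions $X^\star=U^{X^\star}\Sigma^{X^\star}V^\top$, $Y^\star=U^{Y^\star}\Sigma^{Y^\star}V^\top$ (singular values in nonincreasing order) with the same orthogonal matrix $V\in\mathbb{R}^{r\times r}$. For a $C^1$ map $F$ between Euclidean spaces, $\nabla F(x)$ is the derivative; fix for each $x$ an SVD of $\nabla F(x)$ with singular values $\sigma_1^x\ge\sigma_2^x\ge\cdots$, and let $\Pi_j^x$ be the orthogonal projection onto the span of its top $j$ left singular vectors. $B_r(z)$ is the closed ball, $\mathbb{R}_+$ the positive reals. $F$ is locally weakly aligned at $x^\star$ (with $z^\star=F(x^\star)$) with functions $\delta,s:\mathbb{R}_+\to\mathbb{R}_+$ and radius $\varepsilon_{x^\star}>0$ if for all $\rho>0$: whenever $x\in B_{\varepsilon_{x^\star}}(x^\star)$ and $z=F(x)\in B_{\delta(\rho)}(z^\star)$, there is an index $j$ such that $\|(I-\Pi^x_j)(z-z^\star)\|\le\rho\|z-z^\star\|$ and $(\sigma^x_j)^2\ge s(\rho)\|z-z^\star\|$. *)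

theory Defs
  imports "HOL-Analysis.Analysis"
begin

definition orthonormal_on :: "nat set \<Rightarrow> (nat \<Rightarrow> 'a::euclidean_space) \<Rightarrow> bool" where
  "orthonormal_on I w \<longleftrightarrow> (\<forall>i\<in>I. \<forall>k\<in>I. w i \<bullet> w k = (if i = k then 1 else 0))"

text \<open>
  Full singular value decomposition of a linear map between Euclidean spaces, of dimensions
  \<open>n\<close> (domain) and \<open>m\<close> (codomain), indexed from 1. The families \<open>u 1, \<dots>, u m\<close> and
  \<open>v 1, \<dots>, v n\<close> are the columns of the orthogonal factors \<open>U\<close> and \<open>V\<close>, and the displayed sum is
  \<open>U \<Sigma> V\<^sup>T\<close> applied to \<open>x\<close>. Values of \<open>\<sigma>\<close>, \<open>u\<close>, \<open>v\<close> outside these index ranges are irrelevant.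
\<close>

definition is_svd ::
  "('a::euclidean_space \<Rightarrow> 'b::euclidean_space) \<Rightarrow> (nat \<Rightarrow> real) \<Rightarrow> (nat \<Rightarrow> 'b) \<Rightarrow> (nat \<Rightarrow> 'a) \<Rightarrow> bool"
where
  "is_svd A \<sigma> u v \<longleftrightarrow>
     orthonormal_on {1..DIM('b)} u \<and>
     orthonormal_on {1..DIM('a)} v \<and>
     (\<forall>i\<in>{1..min DIM('a) DIM('b)}. 0 \<le> \<sigma> i) \<and>
     (\<forall>i\<in>{1..min DIM('a) DIM('b)}. \<forall>k\<in>{1..min DIM('a) DIM('b)}. i \<le> k \<longrightarrow> \<sigma> k \<le> \<sigma> i) \<and>
     (\<forall>x. A x = (\<Sum>i = 1..min DIM('a) DIM('b). (\<sigma> i * (v i \<bullet> x)) *\<^sub>R u i))"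

text \<open>The \<open>i\<close>-th largest singular value, for \<open>1 \<le> i \<le> min n m\<close>. It does not depend on the
  decomposition chosen: see \<open>singular_value_eq\<close> below.\<close>

definition singular_value :: "('a::euclidean_space \<Rightarrow> 'b::euclidean_space) \<Rightarrow> nat \<Rightarrow> real" where
  "singular_value A i = (THE s. \<exists>\<sigma> u v. is_svd A \<sigma> u v \<and> s = \<sigma> i)"

lemma norm_sum_orthonormal:
  assumes "orthonormal_on I w" "finite I"
  shows "(norm (\<Sum>i\<in>I. c i *\<^sub>R w i))\<^sup>2 = (\<Sum>i\<in>I. (c i)\<^sup>2)"
proof -
  have "(\<Sum>i\<in>I. c i *\<^sub>R w i) \<bullet> (\<Sum>k\<in>I. c k *\<^sub>R w k) =
      (\<Sum>i\<in>I. \<Sum>k\<in>I. c i * (c k * (w i \<bullet> w k)))"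
    by (simp add: inner_sum_left inner_sum_right sum_distrib_left mult_ac inner_commute)
  also have "\<dots> = (\<Sum>i\<in>I. \<Sum>k\<in>I. if i = k then c i * c k else 0)"
    using assms(1) by (intro sum.cong refl) (auto simp: orthonormal_on_def)
  also have "\<dots> = (\<Sum>i\<in>I. (c i)\<^sup>2)"
    using assms(2) by (simp add: power2_eq_square)
  finally show ?thesis by (simp add: power2_norm_eq_inner)
qed

lemma orthonormal_on_subset: "orthonormal_on I w \<Longrightarrow> J \<subseteq> I \<Longrightarrow> orthonormal_on J w"
  unfolding orthonormal_on_def by blast

lemma orthonormal_on_inj: "orthonormal_on I w \<Longrightarrow> inj_on w I"
  by (rule inj_onI) (metis orthonormal_on_def zero_neq_one)

lemma orthonormal_on_independent:
  assumes "orthonormal_on I w" shows "independent (w ` I)"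
proof (rule pairwise_orthogonal_independent)
  show "pairwise orthogonal (w ` I)"
    using assms unfolding pairwise_def orthogonal_def orthonormal_on_def by force
  show "0 \<notin> w ` I"
    using assms unfolding orthonormal_on_def by force
qed

lemma dim_span_orthonormal: "orthonormal_on I w \<Longrightarrow> dim (span (w ` I)) = card I"
  by (simp add: dim_eq_card_independent orthonormal_on_independent card_image orthonormal_on_inj)

lemma orthonormal_on_parseval:
  fixes w :: "nat \<Rightarrow> 'a::euclidean_space"
  assumes "orthonormal_on {1..DIM('a)} w"
  shows "(norm x)\<^sup>2 = (\<Sum>i = 1..DIM('a). (w i \<bullet> x)\<^sup>2)"
proof -
  let ?I = "{1..DIM('a)}"
  let ?y = "\<Sum>i\<in>?I. (w i \<bullet> x) *\<^sub>R w i"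
  have sp: "span (w ` ?I) = UNIV"
    using dim_span_orthonormal[OF assms] by (metis card_atLeastAtMost diff_Suc_1 dim_eq_full span_span)
  have "orthogonal (x - ?y) z" if "z \<in> w ` ?I" for z
  proof -
    from that obtain k where k: "k \<in> ?I" "z = w k" by auto
    have "?y \<bullet> w k = (\<Sum>i\<in>?I. if i = k then w i \<bullet> x else 0)"
      unfolding inner_sum_left using assms k
      by (intro sum.cong refl) (auto simp: orthonormal_on_def)
    then show ?thesis using k by (simp add: orthogonal_def inner_diff_right inner_commute)
  qed
  then have "orthogonal (x - ?y) (x - ?y)"
    using sp orthogonal_to_span[of "x - ?y" "w ` ?I" "x - ?y"] by blast
  then have "x = ?y" by (simp add: orthogonal_def)
  then show ?thesis using norm_sum_orthonormal[OF assms, of "\<lambda>i. w i \<bullet> x"] by simp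
qed

lemma svd_singular_le:
  fixes A :: "'a::euclidean_space \<Rightarrow> 'b::euclidean_space"
  assumes 1: "is_svd A \<sigma> u v" and 2: "is_svd A \<tau> w y" and i: "i \<in> {1..min DIM('a) DIM('b)}"
  shows "\<tau> i \<le> \<sigma> i"
proof (rule ccontr)
  let ?q = "min DIM('a) DIM('b)"
  assume "\<not> \<tau> i \<le> \<sigma> i"
  then have lt: "\<sigma> i < \<tau> i" by simp
  have u: "orthonormal_on {1..DIM('b)} u" and v: "orthonormal_on {1..DIM('a)} v"
    and w: "orthonormal_on {1..DIM('b)} w" and y: "orthonormal_on {1..DIM('a)} y"
    using 1 2 by (auto simp: is_svd_def)
  have on: "orthonormal_on {1..i} y" "orthonormal_on {1..i-1} v"
    using y v i by (auto elim!: orthonormal_on_subset)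
  have normA: "(norm (A x))\<^sup>2 = (\<Sum>k = 1..?q. (s k * (b k \<bullet> x))\<^sup>2)" if "is_svd A s a b" for s a b x
  proof -
    have "orthonormal_on {1..?q} a"
      using that by (auto simp: is_svd_def elim!: orthonormal_on_subset)
    moreover have "A x = (\<Sum>k = 1..?q. (s k * (b k \<bullet> x)) *\<^sub>R a k)"
      using that by (auto simp: is_svd_def)
    ultimately show ?thesis by (simp only: norm_sum_orthonormal finite_atLeastAtMost)
  qed
  define g where "g = (\<lambda>x. \<Sum>k = 1..i-1. (v k \<bullet> x) *\<^sub>R v k)"
  have lin: "linear g"
    unfolding g_def
    by (intro linear_compose_sum ballI linearI) (auto simp: inner_add_right scaleR_add_left)
  have "g ` span (y ` {1..i}) \<subseteq> span (v ` {1..i-1})"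
    unfolding g_def by (auto intro!: span_sum span_scale intro: span_base)
  then have "dim (g ` span (y ` {1..i})) \<le> card {1..i-1}"
    using dim_subset dim_span_orthonormal[OF on(2)] by metis
  moreover have "dim (span (y ` {1..i})) = card {1..i}"
    by (rule dim_span_orthonormal[OF on(1)])
  ultimately have "dim (g ` span (y ` {1..i})) \<noteq> dim (span (y ` {1..i}))"
    using i unfolding card_atLeastAtMost atLeastAtMost_iff by linarith
  then have "\<not> inj_on g (span (y ` {1..i}))"
    using dim_image_eq[OF lin, of "span (y ` {1..i})"] by (auto simp: span_span)
  then obtain x where x: "x \<noteq> 0" "x \<in> span (y ` {1..i})" and gx: "g x = 0"
    using linear_injective_on_subspace_0[OF lin subspace_span] by blast
  have "(\<Sum>k = 1..i-1. (v k \<bullet> x)\<^sup>2) = 0"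
    using norm_sum_orthonormal[OF on(2), of "\<lambda>k. v k \<bullet> x"] gx by (simp add: g_def)
  then have zv: "v k \<bullet> x = 0" if "k \<in> {1..i-1}" for k
    using that by (subst (asm) sum_nonneg_eq_0_iff) auto
  have zy: "y k \<bullet> x = 0" if "k \<in> {1..DIM('a)}" "k \<notin> {1..i}" for k
  proof -
    have "orthogonal (y k) z" if "z \<in> y ` {1..i}" for z
      using that y \<open>k \<in> _\<close> \<open>k \<notin> _\<close> i by (fastforce simp: orthonormal_on_def orthogonal_def)
    then show ?thesis using orthogonal_to_span[of x "y ` {1..i}" "y k"] x(2)
      by (simp add: orthogonal_def)
  qed
  have "(\<tau> i)\<^sup>2 * (norm x)\<^sup>2 = (\<Sum>k = 1..?q. (\<tau> i)\<^sup>2 * (y k \<bullet> x)\<^sup>2)"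
    unfolding orthonormal_on_parseval[OF y, of x] sum_distrib_left
    using zy i by (intro sum.mono_neutral_right) auto
  also have "\<dots> \<le> (\<Sum>k = 1..?q. (\<tau> k * (y k \<bullet> x))\<^sup>2)"
  proof (rule sum_mono)
    fix k assume k: "k \<in> {1..?q}"
    show "(\<tau> i)\<^sup>2 * (y k \<bullet> x)\<^sup>2 \<le> (\<tau> k * (y k \<bullet> x))\<^sup>2"
    proof (cases "k \<le> i")
      case True
      then have "\<tau> i \<le> \<tau> k" "0 \<le> \<tau> i" using 2 k i by (auto simp: is_svd_def)
      then show ?thesis by (simp add: power_mult_distrib mult_right_mono power_mono)
    next
      case False
      then show ?thesis using zy[of k] k by auto
    qed
  qed
  also have "\<dots> = (\<Sum>k = 1..?q. (\<sigma> k * (v k \<bullet> x))\<^sup>2)"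
    using normA[OF 1, of x] normA[OF 2, of x] by simp
  also have "\<dots> \<le> (\<Sum>k = 1..?q. (\<sigma> i)\<^sup>2 * (v k \<bullet> x)\<^sup>2)"
  proof (rule sum_mono)
    fix k assume k: "k \<in> {1..?q}"
    show "(\<sigma> k * (v k \<bullet> x))\<^sup>2 \<le> (\<sigma> i)\<^sup>2 * (v k \<bullet> x)\<^sup>2"
    proof (cases "i \<le> k")
      case True
      then have "\<sigma> k \<le> \<sigma> i" "0 \<le> \<sigma> k" using 1 k i by (auto simp: is_svd_def)
      then show ?thesis by (simp add: power_mult_distrib mult_right_mono power_mono)
    next
      case False
      then show ?thesis using zv[of k] k by auto
    qed
  qed
  also have "\<dots> \<le> (\<Sum>k = 1..DIM('a). (\<sigma> i)\<^sup>2 * (v k \<bullet> x)\<^sup>2)"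
    by (rule sum_mono2) auto
  also have "\<dots> = (\<sigma> i)\<^sup>2 * (norm x)\<^sup>2"
    by (simp add: orthonormal_on_parseval[OF v, of x] sum_distrib_left)
  finally have "(\<tau> i)\<^sup>2 \<le> (\<sigma> i)\<^sup>2" using x(1) by simp
  moreover have "0 \<le> \<sigma> i" using 1 i by (auto simp: is_svd_def)
  ultimately show False using lt power2_le_imp_le by fastforce
qed

lemma singular_value_eq:
  fixes A :: "'a::euclidean_space \<Rightarrow> 'b::euclidean_space"
  assumes "is_svd A \<sigma> u v" "i \<in> {1..min DIM('a) DIM('b)}"
  shows "singular_value A i = \<sigma> i"
  unfolding singular_value_def
proof (rule the_equality)
  show "\<exists>\<sigma>' u v. is_svd A \<sigma>' u v \<and> \<sigma> i = \<sigma>' i" using assms(1) by blast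
next
  fix s assume "\<exists>\<sigma>' u v. is_svd A \<sigma>' u v \<and> s = \<sigma>' i"
  then obtain \<sigma>' u' v' where "is_svd A \<sigma>' u' v'" "s = \<sigma>' i" by blast
  then show "s = \<sigma> i"
    using svd_singular_le[OF assms(1) _ assms(2)] svd_singular_le[OF _ assms(1) assms(2)]
    by (simp add: order.antisym)
qed

definition orthogonal_proj :: "'a::euclidean_space set \<Rightarrow> 'a \<Rightarrow> 'a" where
  "orthogonal_proj S z = (THE p. p \<in> S \<and> (\<forall>y\<in>S. orthogonal (z - p) y))"

lemma orthogonal_proj_span_orthonormal:
  assumes "orthonormal_on I w" "finite I"
  shows "orthogonal_proj (span (w ` I)) z = (\<Sum>i\<in>I. (w i \<bullet> z) *\<^sub>R w i)" (is "_ = ?p")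
  unfolding orthogonal_proj_def
proof (rule the_equality, intro conjI ballI)
  show p: "?p \<in> span (w ` I)"
    by (auto intro!: span_sum span_scale intro: span_base)
  have gen: "orthogonal (z - ?p) y" if "y \<in> w ` I" for y
  proof -
    from that obtain k where k: "k \<in> I" "y = w k" by auto
    have "?p \<bullet> w k = (\<Sum>i\<in>I. if i = k then w i \<bullet> z else 0)"
      unfolding inner_sum_left using assms k
      by (intro sum.cong refl) (auto simp: orthonormal_on_def)
    then show ?thesis using k assms by (simp add: orthogonal_def inner_diff_right inner_commute)
  qed
  show orth: "orthogonal (z - ?p) y" if "y \<in> span (w ` I)" for y
    using orthogonal_to_span[OF that gen] .
  fix q assume q: "q \<in> span (w ` I) \<and> (\<forall>y\<in>span (w ` I). orthogonal (z - q) y)"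
  then have "q - ?p \<in> span (w ` I)" using p by (simp add: span_diff)
  then have "(z - ?p) \<bullet> (q - ?p) = 0" "(z - q) \<bullet> (q - ?p) = 0"
    using q orth by (auto simp: orthogonal_def)
  then have "(q - ?p) \<bullet> (q - ?p) = 0"
    by (simp add: inner_diff_left)
  then show "q = ?p" by simp
qed

text \<open>
  Local weak alignment of \<open>F\<close> at \<open>xs\<close>. The arguments \<open>\<sigma>\<close> and \<open>u\<close> are the singular values and left
  singular vectors of the decomposition of the derivative of \<open>F\<close> that has been fixed at each point.
  An admissible \<open>j\<close> is an index of a singular value. Positivity of \<open>\<epsilon>\<close>, and of \<open>\<delta>\<close> and \<open>s\<close> on the
  positive reals, is part of the notion.
\<close>

definition locally_weakly_aligned ::
  "('a::euclidean_space \<Rightarrow> 'b::euclidean_space) \<Rightarrow> ('a \<Rightarrow> nat \<Rightarrow> real) \<Rightarrow> ('a \<Rightarrow> nat \<Rightarrow> 'b)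
    \<Rightarrow> 'a \<Rightarrow> (real \<Rightarrow> real) \<Rightarrow> (real \<Rightarrow> real) \<Rightarrow> real \<Rightarrow> bool"
where
  "locally_weakly_aligned F \<sigma> u xs \<delta> s \<epsilon> \<longleftrightarrow>
     0 < \<epsilon> \<and>
     (\<forall>\<rho>>0. 0 < \<delta> \<rho> \<and> 0 < s \<rho> \<and>
        (\<forall>x \<in> cball xs \<epsilon>. F x \<in> cball (F xs) (\<delta> \<rho>) \<longrightarrow>
           (\<exists>j \<in> {1..min DIM('a) DIM('b)}.
              norm ((F x - F xs) - orthogonal_proj (span (u x ` {1..j})) (F x - F xs))
                \<le> \<rho> * norm (F x - F xs) \<and>
              (\<sigma> x j)\<^sup>2 \<ge> s \<rho> * norm (F x - F xs))))"

text \<open>\<open>V\<^sup>X = V\<^sup>Y\<close>: the two factors have full decompositions with the same right factor.\<close>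

definition matching_right_singular_vectors :: "real^'r^'m \<Rightarrow> real^'r^'n \<Rightarrow> bool" where
  "matching_right_singular_vectors X Y \<longleftrightarrow>
     (\<exists>\<sigma>X uX \<sigma>Y uY v. is_svd ((*v) X) \<sigma>X uX v \<and> is_svd ((*v) Y) \<sigma>Y uY v)"

text \<open>The norms on matrices and on pairs of matrices are the library ones, which are the Frobenius
  norm and its extension to pairs.\<close>

definition F_asym :: "(real^'r^'m) \<times> (real^'r^'n) \<Rightarrow> real^'n^'m" where
  "F_asym = (\<lambda>(X, Y). X ** transpose Y)"

end

theory Submission
  imports Defs
begin

text \<open>
  The derivative at \<open>(X, Y)\<close> is \<open>D (H, K) = H Y\<^sup>T + X K\<^sup>T\<close>. It is linear in \<open>(X, Y)\<close>, so the Lipschitz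
  bound is the submultiplicativity of the Frobenius norm and one application of Cauchy--Schwarz.

  For the alignment, write \<open>W = X Y\<^sup>T - Z\<close> with \<open>Z\<close> the reference matrix, of rank \<open>k\<close> in this
  outline, and let \<open>X\<^sub>s\<close>, \<open>Y\<^sub>s\<close> be the reference factors with smallest nonzero singular values
  \<open>p\<close> and \<open>q\<close>. The operator \<open>D D\<^sup>T\<close> maps \<open>M\<close> to \<open>X X\<^sup>T M + M Y Y\<^sup>T\<close>. Hence products
  \<open>a\<^sub>i b\<^sub>l\<^sup>T\<close> of left singular vectors of \<open>X\<close> and \<open>Y\<close> are eigenvectors, with eigenvalues
  \<open>\<alpha>\<^sub>i\<^sup>2 + \<beta>\<^sub>l\<^sup>2\<close> (\<open>F_asym_derivative_eigen\<close>). Let \<open>j\<close> be the last index with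
  \<open>(\<sigma> j)\<^sup>2 \<ge> \<tau>\<close> for the threshold \<open>\<tau> = s \<rho> * norm W\<close>. Then the top \<open>j\<close> left singular vectors of \<open>D\<close>
  span a full spectral subspace, and the squared norm of the part of \<open>W\<close> orthogonal to it is the sum
  of \<open>(a\<^sub>i \<bullet> W b\<^sub>l)\<^sup>2\<close> over the pairs with eigenvalue below \<open>\<tau>\<close>, whatever decomposition of \<open>D\<close> was
  fixed (\<open>svd_truncation_residual\<close>).

  Since \<open>\<tau> \<le> min p\<^sup>2 q\<^sup>2 / 4\<close> and \<open>(X, Y)\<close> is close to \<open>(X\<^sub>s, Y\<^sub>s)\<close>, Weyl's inequality
  (\<open>singular_value_perturbation\<close>) leaves only pairs with \<open>i, l > k\<close>. For these,
  \<open>\<bar>a\<^sub>i \<bullet> X Y\<^sup>T b\<^sub>l\<bar> \<le> \<alpha>\<^sub>i \<beta>\<^sub>l\<close>, and it remains to bound \<open>a\<^sub>i \<bullet> Z b\<^sub>l\<close>. The matching of right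
  singular vectors enters twice. First, \<open>Z\<close> has no nonzero singular value below \<open>p q\<close>, so
  \<open>\<bar>a \<bullet> Z b\<bar> \<le> norm (Z\<^sup>T a) * norm (Z b) / (p q)\<close> (\<open>matched_bilinear_bound\<close>). Secondly, the trailing
  right singular vectors of \<open>X\<close> are almost orthogonal to the row space of \<open>X\<^sub>s\<close>, which is that of
  \<open>Y\<^sub>s\<close>, and so \<open>norm (Y X\<^sup>T a\<^sub>i) \<le> q / 7 * \<alpha>\<^sub>i\<close> (\<open>matched_trailing_bound\<close>). This keeps the condition
  numbers of the factors out of \<open>s\<close>. As \<open>Z\<^sup>T a\<^sub>i = Y X\<^sup>T a\<^sub>i - W\<^sup>T a\<^sub>i\<close>, and similarly for
  \<open>Z b\<^sub>l\<close>, everything is expressed through \<open>\<alpha>\<close>, \<open>\<beta>\<close> and \<open>W\<close>. Summed over the pairs, the term that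
  dominates is \<open>(norm W)\<^sup>2 / (p q) \<le> \<rho> / 4 * norm W\<close>, which the choice of \<open>\<delta>\<close> makes small, while the
  trailing singular values contribute at most \<open>(r - k) \<tau>\<close>, where \<open>r\<close> is
  the number of columns of the factors, which the choice of \<open>s\<close> makes small
  (\<open>trailing_block_bound\<close>).

  The decompositions of \<open>X\<close> and \<open>Y\<close> come from the existence theorem \<open>svd_exists\<close>.
\<close>

section \<open>Singular value decompositions of linear maps\<close>

lemma orthonormal_on_expand:
  fixes w :: "nat \<Rightarrow> 'a::euclidean_space"
  assumes "orthonormal_on {1..DIM('a)} w"
  shows "x = (\<Sum>i = 1..DIM('a). (w i \<bullet> x) *\<^sub>R w i)" (is "x = ?y")
proof -
  have "w k \<bullet> (x - ?y) = 0" if "k \<in> {1..DIM('a)}" for k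
  proof -
    have "w k \<bullet> ?y = (\<Sum>i = 1..DIM('a). if i = k then w i \<bullet> x else 0)"
      unfolding inner_sum_right using assms that
      by (intro sum.cong refl) (auto simp: orthonormal_on_def)
    then show ?thesis using that by (simp add: inner_diff_right)
  qed
  then have "(norm (x - ?y))\<^sup>2 = 0"
    by (subst orthonormal_on_parseval[OF assms]) simp
  then show ?thesis by simp
qed

lemma orthonormal_on_Suc:
  assumes "orthonormal_on {1..k} w" "norm z = 1" "\<And>i. i \<in> {1..k} \<Longrightarrow> w i \<bullet> z = 0"
  shows "orthonormal_on {1..Suc k} (w(Suc k := z))"
proof -
  have "z \<bullet> w i = 0" if "i \<in> {1..k}" for i
    using assms(3)[OF that] by (simp add: inner_commute)
  then show ?thesis
    using assms by (auto simp: orthonormal_on_def le_Suc_eq norm_eq_1)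
qed

lemma orthonormal_on_unit_orthogonal_exists:
  fixes w :: "nat \<Rightarrow> 'a::euclidean_space"
  assumes "orthonormal_on {1..k} w" "k < DIM('a)"
  obtains z where "norm z = 1" "\<And>i. i \<in> {1..k} \<Longrightarrow> w i \<bullet> z = 0"
proof -
  have "dim (w ` {1..k}) < DIM('a)"
    using dim_span_orthonormal[OF assms(1)] assms(2) by simp
  then obtain y where y: "y \<noteq> 0" "\<And>x. x \<in> span (w ` {1..k}) \<Longrightarrow> orthogonal y x"
    using orthogonal_to_subspace_exists by blast
  show thesis
  proof
    show "norm (y /\<^sub>R norm y) = 1" using y(1) by simp
    fix i assume "i \<in> {1..k}"
    then have "orthogonal y (w i)" by (intro y(2) span_base) auto
    then show "w i \<bullet> (y /\<^sub>R norm y) = 0" by (simp add: orthogonal_def inner_commute)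
  qed
qed

lemma orthonormal_on_extend:
  fixes w :: "nat \<Rightarrow> 'a::euclidean_space"
  assumes "orthonormal_on {1..k} w" "k \<le> DIM('a)"
  shows "\<exists>w'. orthonormal_on {1..DIM('a)} w' \<and> (\<forall>i\<in>{1..k}. w' i = w i)"
  using assms(2,1)
proof (induction arbitrary: w rule: inc_induct)
  case base
  then show ?case by blast
next
  case (step k)
  obtain z where z: "norm z = 1" "\<And>i. i \<in> {1..k} \<Longrightarrow> w i \<bullet> z = 0"
    using orthonormal_on_unit_orthogonal_exists[OF step.prems step.hyps(2)] by blast
  obtain w' where "orthonormal_on {1..DIM('a)} w'" "\<forall>i\<in>{1..Suc k}. w' i = (w(Suc k := z)) i"
    using step.IH[OF orthonormal_on_Suc[OF step.prems z]] by blast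
  then show ?case by (intro exI[of _ w']) auto
qed

text \<open>The first variation of the Rayleigh quotient: among the directions of a subspace, those
  orthogonal to a maximiser of \<open>norm (A x) / norm x\<close> have images orthogonal to its image.\<close>

lemma maximal_stretch_orthogonal:
  fixes A :: "'a::euclidean_space \<Rightarrow> 'b::euclidean_space"
  assumes A: "linear A" and z: "norm z = 1" "z \<bullet> x = 0"
    and max: "\<And>t. norm (A (z + t *\<^sub>R x)) \<le> norm (A z) * norm (z + t *\<^sub>R x)"
  shows "A z \<bullet> A x = 0"
proof (rule ccontr)
  define c where "c = A z \<bullet> A x"
  define K where "K = (norm (A z))\<^sup>2 * (norm x)\<^sup>2"
  assume "A z \<bullet> A x \<noteq> 0"
  then have c: "c \<noteq> 0" by (simp add: c_def)
  have K: "K \<ge> 0" by (simp add: K_def)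
  have le: "2 * t * c \<le> t\<^sup>2 * K" for t
  proof -
    have "(norm (A (z + t *\<^sub>R x)))\<^sup>2 \<le> (norm (A z))\<^sup>2 * (norm (z + t *\<^sub>R x))\<^sup>2"
      using power_mono[OF max[of t], of 2] by (simp add: power_mult_distrib)
    moreover have "(norm (z + t *\<^sub>R x))\<^sup>2 = 1 + t\<^sup>2 * (norm x)\<^sup>2"
      unfolding power2_norm_eq_inner using z
      by (simp add: inner_add_left inner_add_right inner_commute power2_eq_square norm_eq_1)
    moreover have "(norm (A (z + t *\<^sub>R x)))\<^sup>2 = (norm (A z))\<^sup>2 + 2 * t * c + t\<^sup>2 * (norm (A x))\<^sup>2"
      unfolding power2_norm_eq_inner c_def
      by (simp add: linear_add[OF A] linear_scale[OF A] inner_add_left inner_add_right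
          inner_commute power2_eq_square algebra_simps)
    moreover have "(norm (A z))\<^sup>2 * (1 + t\<^sup>2 * (norm x)\<^sup>2) = (norm (A z))\<^sup>2 + t\<^sup>2 * K"
      by (simp add: K_def algebra_simps)
    ultimately have "2 * t * c + t\<^sup>2 * (norm (A x))\<^sup>2 \<le> t\<^sup>2 * K" by simp
    moreover have "0 \<le> t\<^sup>2 * (norm (A x))\<^sup>2" by simp
    ultimately show ?thesis by linarith
  qed
  define t where "t = c / (K + 1)"
  have t: "t \<noteq> 0" "c = t * (K + 1)" using c K by (auto simp: t_def)
  have "t\<^sup>2 * (2 * (K + 1)) \<le> t\<^sup>2 * K"
    using le[of t] unfolding t(2) by (simp add: power2_eq_square mult_ac)
  then have "2 * (K + 1) \<le> K"
    by (rule mult_left_le_imp_le) (use t(1) in simp)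
  then show False using K by simp
qed

text \<open>The greedy construction of the decomposition: the next right singular vector maximises
  \<open>norm (A x)\<close> over the unit vectors orthogonal to the previous ones. When that maximum is 0, the
  left singular vector is a free choice.\<close>

lemma partial_svd_exists:
  fixes A :: "'a::euclidean_space \<Rightarrow> 'b::euclidean_space"
  assumes A: "linear A"
  shows "k \<le> min DIM('a) DIM('b) \<Longrightarrow> \<exists>\<sigma> u v. orthonormal_on {1..k} u \<and> orthonormal_on {1..k} v \<and>
      (\<forall>i\<in>{1..k}. 0 \<le> \<sigma> i \<and> A (v i) = \<sigma> i *\<^sub>R u i) \<and>
      (\<forall>i\<in>{1..k}. \<forall>l\<in>{1..k}. i \<le> l \<longrightarrow> \<sigma> l \<le> \<sigma> i) \<and>
      (\<forall>x. (\<forall>i\<in>{1..k}. v i \<bullet> x = 0) \<longrightarrow>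
         (\<forall>i\<in>{1..k}. u i \<bullet> A x = 0 \<and> norm (A x) \<le> \<sigma> i * norm x))"
proof (induction k)
  case 0
  show ?case by (simp add: orthonormal_on_def)
next
  case (Suc k)
  then have "k \<le> min DIM('a) DIM('b)" by simp
  from Suc.IH[OF this] obtain \<sigma> :: "nat \<Rightarrow> real" and u v
    where u: "orthonormal_on {1..k} u" and v: "orthonormal_on {1..k} v"
    and sv': "\<forall>i\<in>{1..k}. 0 \<le> \<sigma> i \<and> A (v i) = \<sigma> i *\<^sub>R u i"
    and dec': "\<forall>i\<in>{1..k}. \<forall>l\<in>{1..k}. i \<le> l \<longrightarrow> \<sigma> l \<le> \<sigma> i"
    and bd': "\<forall>x. (\<forall>i\<in>{1..k}. v i \<bullet> x = 0) \<longrightarrow>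
         (\<forall>i\<in>{1..k}. u i \<bullet> A x = 0 \<and> norm (A x) \<le> \<sigma> i * norm x)"
    by (elim exE conjE)
  note sv = sv'[rule_format, THEN conjunct1] sv'[rule_format, THEN conjunct2]
  note dec = dec'[rule_format]
  have perp: "u i \<bullet> A x = 0" if "\<forall>i\<in>{1..k}. v i \<bullet> x = 0" "i \<in> {1..k}" for x i
    using bd' that by blast
  have bd: "norm (A x) \<le> \<sigma> i * norm x" if "\<forall>i\<in>{1..k}. v i \<bullet> x = 0" "i \<in> {1..k}" for x i
    using bd' that by blast
  have ka: "k < DIM('a)" and kb: "k < DIM('b)" using Suc.prems by auto
  define S where "S = {x. \<forall>i\<in>{1..k}. v i \<bullet> x = 0}"
  have "S = (\<Inter>i\<in>{1..k}. {x. v i \<bullet> x = 0})" by (auto simp: S_def)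
  then have "closed S" by (simp add: closed_INT closed_hyperplane)
  then have "compact (sphere 0 1 \<inter> S)" by (intro compact_Int_closed compact_sphere)
  moreover obtain z0 where "norm z0 = 1" "\<And>i. i \<in> {1..k} \<Longrightarrow> v i \<bullet> z0 = 0"
    using orthonormal_on_unit_orthogonal_exists[OF v ka] by blast
  then have "z0 \<in> sphere 0 1 \<inter> S" by (simp add: S_def)
  moreover have "continuous_on (sphere 0 1 \<inter> S) (\<lambda>x. norm (A x))"
    using A by (intro continuous_intros linear_continuous_on) (simp add: linear_conv_bounded_linear)
  ultimately obtain z where z: "z \<in> sphere 0 1 \<inter> S"
    and zmax: "\<And>y. y \<in> sphere 0 1 \<inter> S \<Longrightarrow> norm (A y) \<le> norm (A z)"
    using continuous_attains_sup[of "sphere 0 1 \<inter> S" "\<lambda>x. norm (A x)"] by blast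
  have z1: "norm z = 1" and zS: "\<And>i. i \<in> {1..k} \<Longrightarrow> v i \<bullet> z = 0" using z by (auto simp: S_def)
  define s where "s = norm (A z)"
  have max: "norm (A x) \<le> s * norm x" if "x \<in> S" for x
  proof (cases "x = 0")
    case False
    have "x /\<^sub>R norm x \<in> sphere 0 1 \<inter> S" using that False by (simp add: S_def)
    from zmax[OF this] show ?thesis
      using False by (simp add: linear_scale[OF A] s_def field_simps)
  qed (simp add: linear_0[OF A])
  obtain y where y: "norm y = 1" "\<And>i. i \<in> {1..k} \<Longrightarrow> u i \<bullet> y = 0" "A z = s *\<^sub>R y"
  proof (cases "s = 0")
    case True
    then have "A z = s *\<^sub>R y" for y by (simp add: s_def)
    moreover obtain y where "norm y = 1" "\<And>i. i \<in> {1..k} \<Longrightarrow> u i \<bullet> y = 0"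
      using orthonormal_on_unit_orthogonal_exists[OF u kb] by blast
    ultimately show thesis using that by blast
  next
    case False
    have "u i \<bullet> A z = 0" if "i \<in> {1..k}" for i using perp zS that by blast
    with False show thesis by (intro that[of "A z /\<^sub>R s"]) (auto simp: s_def)
  qed
  have zx: "y \<bullet> A x = 0" if "x \<in> S" "z \<bullet> x = 0" for x
  proof (cases "s = 0")
    case True
    then show ?thesis using max[OF that(1)] by simp
  next
    case False
    have "A z \<bullet> A x = 0"
    proof (rule maximal_stretch_orthogonal[OF A z1 that(2)])
      fix t
      have "z + t *\<^sub>R x \<in> S" using z that(1) by (simp add: S_def inner_add_right)
      then show "norm (A (z + t *\<^sub>R x)) \<le> norm (A z) * norm (z + t *\<^sub>R x)"
        using max by (simp add: s_def)
    qed
    then show ?thesis using False by (simp add: y(3))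
  qed
  have s\<sigma>: "s \<le> \<sigma> i" if "i \<in> {1..k}" for i
    using bd[of z i] zS that z1 by (simp add: s_def)
  have sub: "x \<in> S \<and> z \<bullet> x = 0" if "\<forall>i\<in>{1..Suc k}. (v(Suc k := z)) i \<bullet> x = 0" for x
  proof -
    have "v i \<bullet> x = 0" if i: "i \<in> {1..k}" for i
      using \<open>\<forall>i\<in>{1..Suc k}. _ i\<close>[rule_format, of i] i by auto
    then show ?thesis using that[rule_format, of "Suc k"] by (simp add: S_def)
  qed
  show ?case
  proof (intro exI conjI)
    show "orthonormal_on {1..Suc k} (u(Suc k := y))" using orthonormal_on_Suc[OF u y(1,2)] .
    show "orthonormal_on {1..Suc k} (v(Suc k := z))" using orthonormal_on_Suc[OF v z1 zS] .
    show "\<forall>i\<in>{1..Suc k}. 0 \<le> (\<sigma>(Suc k := s)) i \<and>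
        A ((v(Suc k := z)) i) = (\<sigma>(Suc k := s)) i *\<^sub>R (u(Suc k := y)) i"
      using sv y(3) by (auto simp: s_def le_Suc_eq)
    show "\<forall>i\<in>{1..Suc k}. \<forall>l\<in>{1..Suc k}. i \<le> l \<longrightarrow> (\<sigma>(Suc k := s)) l \<le> (\<sigma>(Suc k := s)) i"
      using dec s\<sigma> by (auto simp: le_Suc_eq)
    show "\<forall>x. (\<forall>i\<in>{1..Suc k}. (v(Suc k := z)) i \<bullet> x = 0) \<longrightarrow>
        (\<forall>i\<in>{1..Suc k}. (u(Suc k := y)) i \<bullet> A x = 0 \<and> norm (A x) \<le> (\<sigma>(Suc k := s)) i * norm x)"
    proof (intro allI impI ballI)
      fix x i assume x: "\<forall>i\<in>{1..Suc k}. (v(Suc k := z)) i \<bullet> x = 0" and i: "i \<in> {1..Suc k}"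
      then have S: "x \<in> S" "z \<bullet> x = 0" using sub by auto
      then have "\<forall>i\<in>{1..k}. v i \<bullet> x = 0" by (simp add: S_def)
      then show "(u(Suc k := y)) i \<bullet> A x = 0 \<and> norm (A x) \<le> (\<sigma>(Suc k := s)) i * norm x"
        using i perp[of x i] bd[of x i] zx[OF S] max[OF S(1)] by (cases "i = Suc k") auto
    qed
  qed
qed

lemma is_svd_restrict:
  fixes A :: "'a::euclidean_space \<Rightarrow> 'b::euclidean_space"
  assumes "is_svd A \<sigma> u v"
  shows "is_svd A (\<lambda>i. if i \<le> min DIM('a) DIM('b) then \<sigma> i else 0) u v"
proof -
  have "(\<Sum>i = 1..min DIM('a) DIM('b). ((if i \<le> min DIM('a) DIM('b) then \<sigma> i else 0) * (v i \<bullet> x)) *\<^sub>R u i)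
     = (\<Sum>i = 1..min DIM('a) DIM('b). (\<sigma> i * (v i \<bullet> x)) *\<^sub>R u i)" for x
    by (intro sum.cong) auto
  then show ?thesis using assms by (simp add: is_svd_def)
qed

lemma svd_exists:
  fixes A :: "'a::euclidean_space \<Rightarrow> 'b::euclidean_space"
  assumes A: "linear A"
  obtains \<sigma> u v where "is_svd A \<sigma> u v" "\<And>i. min DIM('a) DIM('b) < i \<Longrightarrow> \<sigma> i = 0"
proof -
  let ?q = "min DIM('a) DIM('b)"
  from partial_svd_exists[OF A order_refl] obtain \<sigma> :: "nat \<Rightarrow> real" and u0 v0
    where u0: "orthonormal_on {1..?q} u0" and v0: "orthonormal_on {1..?q} v0"
    and sv: "\<forall>i\<in>{1..?q}. 0 \<le> \<sigma> i \<and> A (v0 i) = \<sigma> i *\<^sub>R u0 i"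
    and dec: "\<forall>i\<in>{1..?q}. \<forall>l\<in>{1..?q}. i \<le> l \<longrightarrow> \<sigma> l \<le> \<sigma> i"
    and perp: "\<forall>x. (\<forall>i\<in>{1..?q}. v0 i \<bullet> x = 0) \<longrightarrow>
         (\<forall>i\<in>{1..?q}. u0 i \<bullet> A x = 0 \<and> norm (A x) \<le> \<sigma> i * norm x)"
    by (elim exE conjE)
  obtain u where u: "orthonormal_on {1..DIM('b)} u" "\<And>i. i \<in> {1..?q} \<Longrightarrow> u i = u0 i"
    using orthonormal_on_extend[OF u0] by (metis min.cobounded2)
  obtain v where v: "orthonormal_on {1..DIM('a)} v" "\<And>i. i \<in> {1..?q} \<Longrightarrow> v i = v0 i"
    using orthonormal_on_extend[OF v0] by (metis min.cobounded1)
  \<comment> \<open>A right singular vector beyond the codomain dimension is mapped to the orthogonal complement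
     of a full basis.\<close>
  have zero: "A (v i) = 0" if i: "i \<in> {1..DIM('a)}" "i \<notin> {1..?q}" for i
  proof -
    have q: "?q = DIM('b)" using i by auto
    have "\<forall>l\<in>{1..?q}. v0 l \<bullet> v i = 0"
    proof
      fix l assume l: "l \<in> {1..?q}"
      then have "v l \<bullet> v i = 0"
        using v(1) i unfolding orthonormal_on_def by force
      then show "v0 l \<bullet> v i = 0" using v(2)[OF l] by simp
    qed
    then have "\<forall>l\<in>{1..DIM('b)}. u l \<bullet> A (v i) = 0" using perp u(2) q by metis
    then have "(norm (A (v i)))\<^sup>2 = 0"
      by (subst orthonormal_on_parseval[OF u(1)]) simp
    then show ?thesis by simp
  qed
  have "A x = (\<Sum>i = 1..?q. (\<sigma> i * (v i \<bullet> x)) *\<^sub>R u i)" for x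
  proof -
    have "A x = A (\<Sum>i = 1..DIM('a). (v i \<bullet> x) *\<^sub>R v i)" using orthonormal_on_expand[OF v(1), of x] by simp
    also have "\<dots> = (\<Sum>i = 1..DIM('a). (v i \<bullet> x) *\<^sub>R A (v i))"
      by (simp add: linear_sum[OF A] linear_scale[OF A])
    also have "\<dots> = (\<Sum>i = 1..?q. (v i \<bullet> x) *\<^sub>R A (v i))"
      using zero by (intro sum.mono_neutral_right) auto
    also have "\<dots> = (\<Sum>i = 1..?q. (\<sigma> i * (v i \<bullet> x)) *\<^sub>R u i)"
      using sv u(2) v(2) by (intro sum.cong refl) (simp add: mult.commute)
    finally show ?thesis .
  qed
  then have "is_svd A \<sigma> u v"
    using u(1) v(1) sv dec by (auto simp: is_svd_def)
  from is_svd_restrict[OF this] show thesis by (rule that) auto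
qed

text \<open>With singular values continued by 0, the index ranges of the two orthonormal bases need not be
  distinguished in the identities below.\<close>

lemma svd_linear: "is_svd A \<sigma> u v \<Longrightarrow> linear A"
  by (rule linearI) (simp_all add: is_svd_def inner_add_right algebra_simps sum.distrib scaleR_sum_right)

lemma svd_inner:
  fixes A :: "'a::euclidean_space \<Rightarrow> 'b::euclidean_space"
  assumes A: "is_svd A \<sigma> u v" and z: "\<And>i. min DIM('a) DIM('b) < i \<Longrightarrow> \<sigma> i = 0"
    and l: "l \<in> {1..DIM('b)}"
  shows "u l \<bullet> A x = \<sigma> l * (v l \<bullet> x)"
proof -
  have "u l \<bullet> A x = (\<Sum>i = 1..min DIM('a) DIM('b). \<sigma> i * (v i \<bullet> x) * (u l \<bullet> u i))"
    using A by (simp add: is_svd_def inner_sum_right)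
  also have "\<dots> = (\<Sum>i = 1..min DIM('a) DIM('b). if i = l then \<sigma> i * (v i \<bullet> x) else 0)"
    using A l by (intro sum.cong refl) (simp add: is_svd_def orthonormal_on_def)
  also have "\<dots> = \<sigma> l * (v l \<bullet> x)"
    using z[of l] l by (auto simp: sum.delta)
  finally show ?thesis .
qed

lemma svd_apply:
  fixes A :: "'a::euclidean_space \<Rightarrow> 'b::euclidean_space"
  assumes A: "is_svd A \<sigma> u v" and z: "\<And>i. min DIM('a) DIM('b) < i \<Longrightarrow> \<sigma> i = 0"
    and l: "l \<in> {1..DIM('a)}"
  shows "A (v l) = \<sigma> l *\<^sub>R u l"
proof -
  have "A (v l) = (\<Sum>i = 1..min DIM('a) DIM('b). (\<sigma> i * (v i \<bullet> v l)) *\<^sub>R u i)"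
    using A unfolding is_svd_def by blast
  also have "\<dots> = (\<Sum>i = 1..min DIM('a) DIM('b). if i = l then \<sigma> i *\<^sub>R u i else 0)"
    using A l by (intro sum.cong refl) (simp add: is_svd_def orthonormal_on_def)
  also have "\<dots> = \<sigma> l *\<^sub>R u l"
    using z[of l] l by (auto simp: sum.delta)
  finally show ?thesis .
qed

lemma svd_adjoint:
  fixes A :: "'a::euclidean_space \<Rightarrow> 'b::euclidean_space"
  assumes A: "is_svd A \<sigma> u v" and z: "\<And>i. min DIM('a) DIM('b) < i \<Longrightarrow> \<sigma> i = 0"
    and l: "l \<in> {1..DIM('b)}"
  shows "adjoint A (u l) = \<sigma> l *\<^sub>R v l"
proof (rule vector_eq_rdot[THEN iffD1], rule allI)
  fix x
  show "adjoint A (u l) \<bullet> x = (\<sigma> l *\<^sub>R v l) \<bullet> x"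
    using svd_inner[OF A z l, of x] by (simp add: adjoint_works[OF svd_linear[OF A]] inner_commute)
qed

lemma svd_gram:
  fixes A :: "'a::euclidean_space \<Rightarrow> 'b::euclidean_space"
  assumes A: "is_svd A \<sigma> u v" and z: "\<And>i. min DIM('a) DIM('b) < i \<Longrightarrow> \<sigma> i = 0"
    and l: "l \<in> {1..DIM('b)}"
  shows "A (adjoint A (u l)) = (\<sigma> l)\<^sup>2 *\<^sub>R u l"
proof (cases "l \<le> min DIM('a) DIM('b)")
  case True
  then have "l \<in> {1..DIM('a)}" using l by simp
  then show ?thesis
    using svd_apply[OF A z]
    by (simp add: svd_adjoint[OF A z l] linear_scale[OF svd_linear[OF A]] power2_eq_square)
next
  case False
  then have "min DIM('a) DIM('b) < l" by linarith
  then have "\<sigma> l = 0" by (rule z)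
  then show ?thesis
    by (simp add: svd_adjoint[OF A z l] linear_0[OF svd_linear[OF A]])
qed

lemma svd_norm_adjoint:
  fixes A :: "'a::euclidean_space \<Rightarrow> 'b::euclidean_space"
  assumes A: "is_svd A \<sigma> u v" and z: "\<And>i. min DIM('a) DIM('b) < i \<Longrightarrow> \<sigma> i = 0"
    and l: "l \<in> {1..DIM('b)}"
  shows "norm (adjoint A (u l)) = \<sigma> l"
proof -
  have ul: "u l \<bullet> u l = 1" using A l by (auto simp: is_svd_def orthonormal_on_def)
  have "(norm (adjoint A (u l)))\<^sup>2 = A (adjoint A (u l)) \<bullet> u l"
    by (simp add: power2_norm_eq_inner adjoint_works[OF svd_linear[OF A]])
  also have "\<dots> = (\<sigma> l)\<^sup>2"
    using ul by (simp add: svd_gram[OF A z l])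
  finally have "(norm (adjoint A (u l)))\<^sup>2 = (\<sigma> l)\<^sup>2" .
  moreover have "0 \<le> \<sigma> l"
    using A z[of l] l by (cases "l \<le> min DIM('a) DIM('b)") (auto simp: is_svd_def)
  ultimately show ?thesis by (simp add: power2_eq_iff_nonneg)
qed

lemma svd_norm:
  fixes A :: "'a::euclidean_space \<Rightarrow> 'b::euclidean_space"
  assumes A: "is_svd A \<sigma> u v"
  shows "(norm (A x))\<^sup>2 = (\<Sum>i = 1..min DIM('a) DIM('b). (\<sigma> i)\<^sup>2 * (v i \<bullet> x)\<^sup>2)"
proof -
  have "orthonormal_on {1..min DIM('a) DIM('b)} u" and
    "A x = (\<Sum>i = 1..min DIM('a) DIM('b). (\<sigma> i * (v i \<bullet> x)) *\<^sub>R u i)"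
    using A by (auto simp: is_svd_def elim!: orthonormal_on_subset)
  then show ?thesis by (simp only: norm_sum_orthonormal finite_atLeastAtMost power_mult_distrib)
qed

section \<open>Perturbation, rank, and truncation\<close>

lemma svd_mono:
  fixes A :: "'a::euclidean_space \<Rightarrow> 'b::euclidean_space"
  assumes "is_svd A \<sigma> u v" "1 \<le> i" "i \<le> k" "k \<le> min DIM('a) DIM('b)"
  shows "\<sigma> k \<le> \<sigma> i"
proof -
  have "i \<in> {1..min DIM('a) DIM('b)}" "k \<in> {1..min DIM('a) DIM('b)}" using assms(2-4) by auto
  then show ?thesis using assms(1,3) unfolding is_svd_def by blast
qed

lemma svd_norm_ge:
  fixes A :: "'a::euclidean_space \<Rightarrow> 'b::euclidean_space"
  assumes A: "is_svd A \<sigma> u v" and i: "i \<in> {1..min DIM('a) DIM('b)}"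
    and x: "\<And>k. k \<in> {i<..DIM('a)} \<Longrightarrow> v k \<bullet> x = 0"
  shows "\<sigma> i * norm x \<le> norm (A x)"
proof -
  have v: "orthonormal_on {1..DIM('a)} v" using A by (simp add: is_svd_def)
  have "(\<sigma> i * norm x)\<^sup>2 = (\<Sum>k = 1..DIM('a). (\<sigma> i)\<^sup>2 * (v k \<bullet> x)\<^sup>2)"
    by (simp add: power_mult_distrib orthonormal_on_parseval[OF v, of x] sum_distrib_left)
  also have "\<dots> = (\<Sum>k = 1..i. (\<sigma> i)\<^sup>2 * (v k \<bullet> x)\<^sup>2)"
    using x i by (intro sum.mono_neutral_right) auto
  also have "\<dots> \<le> (\<Sum>k = 1..i. (\<sigma> k)\<^sup>2 * (v k \<bullet> x)\<^sup>2)"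
    using A i by (intro sum_mono mult_right_mono power_mono) (auto simp: is_svd_def)
  also have "\<dots> \<le> (\<Sum>k = 1..min DIM('a) DIM('b). (\<sigma> k)\<^sup>2 * (v k \<bullet> x)\<^sup>2)"
    using i by (intro sum_mono2) auto
  also have "\<dots> = (norm (A x))\<^sup>2" by (simp only: svd_norm[OF A])
  finally show ?thesis by (rule power2_le_imp_le) simp
qed

lemma svd_norm_le:
  fixes A :: "'a::euclidean_space \<Rightarrow> 'b::euclidean_space"
  assumes A: "is_svd A \<sigma> u v" and i: "i \<in> {1..min DIM('a) DIM('b)}"
    and x: "\<And>k. k \<in> {1..<i} \<Longrightarrow> v k \<bullet> x = 0"
  shows "norm (A x) \<le> \<sigma> i * norm x"
proof -
  have v: "orthonormal_on {1..DIM('a)} v" using A by (simp add: is_svd_def)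
  have \<sigma>: "0 \<le> \<sigma> k" "i \<le> k \<Longrightarrow> \<sigma> k \<le> \<sigma> i" if "k \<in> {1..min DIM('a) DIM('b)}" for k
    using A i that by (auto simp: is_svd_def)
  have "(norm (A x))\<^sup>2 = (\<Sum>k = 1..min DIM('a) DIM('b). (\<sigma> k)\<^sup>2 * (v k \<bullet> x)\<^sup>2)"
    by (simp only: svd_norm[OF A])
  also have "\<dots> = (\<Sum>k = i..min DIM('a) DIM('b). (\<sigma> k)\<^sup>2 * (v k \<bullet> x)\<^sup>2)"
    using x i by (intro sum.mono_neutral_right) auto
  also have "\<dots> \<le> (\<Sum>k = i..min DIM('a) DIM('b). (\<sigma> i)\<^sup>2 * (v k \<bullet> x)\<^sup>2)"
    using \<sigma> i by (intro sum_mono mult_right_mono power_mono) auto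
  also have "\<dots> \<le> (\<Sum>k = 1..DIM('a). (\<sigma> i)\<^sup>2 * (v k \<bullet> x)\<^sup>2)"
    using i by (intro sum_mono2) auto
  also have "\<dots> = (\<sigma> i * norm x)\<^sup>2"
    by (simp add: power_mult_distrib orthonormal_on_parseval[OF v, of x] sum_distrib_left)
  finally show ?thesis by (rule power2_le_imp_le) (use \<sigma>(1)[OF i] in simp)
qed

text \<open>Weyl's inequality. The \<open>i - 1\<close> leading directions of \<open>B\<close> and the \<open>n - i\<close> trailing ones of \<open>A\<close>
  do not span the space, so some vector is orthogonal to all of them; there \<open>A\<close> stretches by at
  least its \<open>i\<close>-th singular value and \<open>B\<close> by at most its own.\<close>

lemma singular_value_perturbation:
  fixes A B :: "'a::euclidean_space \<Rightarrow> 'b::euclidean_space"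
  assumes A: "is_svd A \<sigma> u v" and B: "is_svd B \<tau> w y"
    and C: "\<And>x. norm (A x - B x) \<le> C * norm x" and i: "i \<in> {1..min DIM('a) DIM('b)}"
  shows "\<sigma> i \<le> \<tau> i + C"
proof -
  let ?T = "y ` {1..<i} \<union> v ` {i<..DIM('a)}"
  have "card ?T \<le> card {1..<i} + card {i<..DIM('a)}"
    by (intro order_trans[OF card_Un_le] add_mono card_image_le) auto
  also have "\<dots> < DIM('a)" using i by auto
  finally have "dim ?T < DIM('a)"
    using dim_le_card'[of ?T] by simp
  then obtain x where x: "x \<noteq> 0" "\<And>t. t \<in> span ?T \<Longrightarrow> orthogonal x t"
    using orthogonal_to_subspace_exists by blast
  have "\<sigma> i * norm x \<le> norm (A x)"
  proof (rule svd_norm_ge[OF A i])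
    fix k assume "k \<in> {i<..DIM('a)}"
    then have "orthogonal x (v k)" by (intro x(2) span_base) auto
    then show "v k \<bullet> x = 0" by (simp add: orthogonal_def inner_commute)
  qed
  also have "\<dots> \<le> norm (B x) + norm (A x - B x)"
    using norm_triangle_ineq[of "B x" "A x - B x"] by simp
  also have "norm (B x) \<le> \<tau> i * norm x"
  proof (rule svd_norm_le[OF B i])
    fix k assume "k \<in> {1..<i}"
    then have "orthogonal x (y k)" by (intro x(2) span_base) auto
    then show "y k \<bullet> x = 0" by (simp add: orthogonal_def inner_commute)
  qed
  also note C[of x]
  finally have "\<sigma> i * norm x \<le> (\<tau> i + C) * norm x" by (simp add: algebra_simps)
  then show ?thesis using x(1) by simp
qed

lemma svd_dim_range:
  fixes A :: "'a::euclidean_space \<Rightarrow> 'b::euclidean_space"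
  assumes A: "is_svd A \<sigma> u v"
  shows "dim (range A) = card {i \<in> {1..min DIM('a) DIM('b)}. 0 < \<sigma> i}"
proof -
  let ?q = "min DIM('a) DIM('b)"
  define T where "T = {i \<in> {1..?q}. 0 < \<sigma> i}"
  have u: "orthonormal_on T u" and v: "orthonormal_on {1..DIM('a)} v"
    using A by (auto simp: is_svd_def T_def elim!: orthonormal_on_subset)
  note A' = is_svd_restrict[OF A]
  have A'0: "(if i \<le> ?q then \<sigma> i else 0) = 0" if "?q < i" for i using that by auto
  have "range A = span (u ` T)"
  proof
    show "range A \<subseteq> span (u ` T)"
    proof safe
      fix x
      have "A x = (\<Sum>i = 1..?q. (\<sigma> i * (v i \<bullet> x)) *\<^sub>R u i)"
        using A by (auto simp: is_svd_def)
      also have "\<dots> = (\<Sum>i\<in>T. (\<sigma> i * (v i \<bullet> x)) *\<^sub>R u i)"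
        using A by (intro sum.mono_neutral_right) (auto simp: T_def is_svd_def less_le)
      also have "\<dots> \<in> span (u ` T)"
        by (auto intro!: span_sum span_scale intro: span_base)
      finally show "A x \<in> span (u ` T)" .
    qed
    have "u ` T \<subseteq> range A"
    proof safe
      fix i assume i: "i \<in> T"
      then have "A (v i) = \<sigma> i *\<^sub>R u i"
        using svd_apply[OF A' A'0, of i] by (auto simp: T_def)
      then have "A (v i /\<^sub>R \<sigma> i) = u i"
        using i by (simp add: linear_scale[OF svd_linear[OF A]] T_def)
      then show "u i \<in> range A" by (metis rangeI)
    qed
    then show "span (u ` T) \<subseteq> range A"
      by (intro span_minimal linear_subspace_image[OF svd_linear[OF A]]) auto
  qed
  then show ?thesis using dim_span_orthonormal[OF u] by (simp add: T_def)
qed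

lemma svd_rank:
  fixes A :: "'a::euclidean_space \<Rightarrow> 'b::euclidean_space"
  assumes A: "is_svd A \<sigma> u v" and k: "dim (range A) = k" "1 \<le> k"
  shows "k \<le> min DIM('a) DIM('b)" and "0 < \<sigma> k"
    and "\<And>i. i \<in> {k<..min DIM('a) DIM('b)} \<Longrightarrow> \<sigma> i = 0"
proof -
  let ?q = "min DIM('a) DIM('b)"
  define T where "T = {i \<in> {1..?q}. 0 < \<sigma> i}"
  have cT: "card T = k" using svd_dim_range[OF A] k by (simp add: T_def)
  have fin: "finite T" and Tq: "T \<subseteq> {1..?q}" by (auto simp: T_def)
  have down: "{1..i} \<subseteq> T" if "i \<in> T" for i
  proof
    fix l assume l: "l \<in> {1..i}"
    then have "\<sigma> i \<le> \<sigma> l" using A that by (auto simp: is_svd_def T_def)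
    then show "l \<in> T" using l that by (auto simp: T_def)
  qed
  have ne: "T \<noteq> {}" using cT k by auto
  have "T = {1..Max T}"
    using down[OF Max_in[OF fin ne]] Tq Max_ge[OF fin] by fastforce
  then have T: "T = {1..k}" using cT by (metis card_atLeastAtMost diff_Suc_1)
  then have "k \<in> T" using k by simp
  then show "k \<le> ?q" "0 < \<sigma> k" by (auto simp: T_def)
  fix i assume i: "i \<in> {k<..?q}"
  then have "i \<notin> T" by (simp add: T)
  moreover have "0 \<le> \<sigma> i" using i A by (auto simp: is_svd_def)
  ultimately show "\<sigma> i = 0" using i by (auto simp: T_def)
qed

text \<open>Cutting the left singular vectors of \<open>A\<close> at the last singular value whose square is at least
  \<open>\<tau>\<close> gives the spectral projection of \<open>A A\<^sup>T\<close> for \<open>[\<tau>, \<infinity>)\<close>. It can therefore be computed in any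
  eigenbasis of \<open>A A\<^sup>T\<close>, whatever decomposition of \<open>A\<close> was chosen.\<close>

lemma svd_truncation_residual:
  fixes A :: "'a::euclidean_space \<Rightarrow> 'b::euclidean_space" and e :: "'i \<Rightarrow> 'b"
  assumes A: "is_svd A \<sigma> u v"
    and eig: "\<And>i. i \<in> I \<Longrightarrow> A (adjoint A (e i)) = \<mu> i *\<^sub>R e i"
    and fin: "finite I"
    and pars: "\<And>x. (norm x)\<^sup>2 = (\<Sum>i\<in>I. (e i \<bullet> x)\<^sup>2)"
    and i0: "i0 \<in> I" "e i0 \<noteq> 0" "\<tau> \<le> \<mu> i0" and \<tau>: "0 < \<tau>"
  shows "\<exists>j\<in>{1..min DIM('a) DIM('b)}. \<tau> \<le> (\<sigma> j)\<^sup>2 \<and>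
    (norm (W - orthogonal_proj (span (u ` {1..j})) W))\<^sup>2 = (\<Sum>i\<in>{i\<in>I. \<mu> i < \<tau>}. (e i \<bullet> W)\<^sup>2)"
proof -
  let ?q = "min DIM('a) DIM('b)"
  have u: "orthonormal_on {1..DIM('b)} u" using A by (simp add: is_svd_def)
  define \<sigma>' where "\<sigma>' = (\<lambda>i. if i \<le> ?q then \<sigma> i else 0)"
  have A': "is_svd A \<sigma>' u v" unfolding \<sigma>'_def by (rule is_svd_restrict[OF A])
  have \<sigma>'0: "\<sigma>' i = 0" if "?q < i" for i using that by (auto simp: \<sigma>'_def)
  \<comment> \<open>Eigenvectors of the symmetric map \<open>A A\<^sup>T\<close> for distinct eigenvalues are orthogonal.\<close>
  have key: "\<mu> i = (\<sigma>' l)\<^sup>2" if "i \<in> I" "l \<in> {1..DIM('b)}" "u l \<bullet> e i \<noteq> 0" for i l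
  proof -
    have "\<mu> i * (u l \<bullet> e i) = u l \<bullet> A (adjoint A (e i))"
      by (simp add: eig[OF that(1)])
    also have "\<dots> = \<sigma>' l * (v l \<bullet> adjoint A (e i))"
      by (rule svd_inner[OF A' \<sigma>'0 that(2)])
    also have "\<dots> = adjoint A (u l) \<bullet> adjoint A (e i)"
      by (simp add: svd_adjoint[OF A' \<sigma>'0 that(2)])
    also have "\<dots> = A (adjoint A (u l)) \<bullet> e i"
      by (simp add: adjoint_works[OF svd_linear[OF A]])
    also have "A (adjoint A (u l)) = (\<sigma>' l)\<^sup>2 *\<^sub>R u l"
      by (rule svd_gram[OF A' \<sigma>'0 that(2)])
    finally show ?thesis using that(3) by simp
  qed
  define J where "J = {l \<in> {1..?q}. \<tau> \<le> (\<sigma> l)\<^sup>2}"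
  have "\<exists>l\<in>{1..DIM('b)}. u l \<bullet> e i0 \<noteq> 0"
  proof (rule ccontr)
    assume "\<not> ?thesis"
    then have "(norm (e i0))\<^sup>2 = 0" by (subst orthonormal_on_parseval[OF u]) auto
    then show False using i0(2) by simp
  qed
  then obtain l where l: "l \<in> {1..DIM('b)}" "u l \<bullet> e i0 \<noteq> 0" by blast
  then have "\<tau> \<le> (\<sigma>' l)\<^sup>2" using key[OF i0(1)] i0(3) by simp
  then have "l \<in> J" using l(1) \<tau> by (auto simp: J_def \<sigma>'_def split: if_splits)
  then have ne: "J \<noteq> {}" by blast
  have fJ: "finite J" by (simp add: J_def)
  define j where "j = Max J"
  have jJ: "j \<in> J" unfolding j_def by (rule Max_in[OF fJ ne])
  then have j: "j \<in> {1..?q}" "\<tau> \<le> (\<sigma> j)\<^sup>2" by (auto simp: J_def)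
  have head: "\<tau> \<le> (\<sigma>' l)\<^sup>2" if "l \<in> {1..j}" for l
  proof -
    have "\<sigma> j \<le> \<sigma> l" "0 \<le> \<sigma> j" using that j A by (auto simp: is_svd_def)
    then have "(\<sigma> j)\<^sup>2 \<le> (\<sigma> l)\<^sup>2" by (rule power_mono)
    then show ?thesis using that j by (simp add: \<sigma>'_def)
  qed
  have tail: "(\<sigma>' l)\<^sup>2 < \<tau>" if "l \<in> {j<..DIM('b)}" for l
  proof (cases "l \<le> ?q")
    case True
    have "l \<notin> J" using that Max_ge[OF fJ, of l] by (auto simp: j_def)
    then show ?thesis using True that by (simp add: J_def \<sigma>'_def)
  next
    case False
    then have "?q < l" by linarith
    then show ?thesis using \<sigma>'0 \<tau> by simp
  qed
  have uj: "orthonormal_on {1..j} u"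
    using j by (intro orthonormal_on_subset[OF u]) auto
  define p where "p = (\<Sum>l = 1..j. (u l \<bullet> W) *\<^sub>R u l)"
  define N where "N = (\<Sum>l\<in>{j<..DIM('b)}. (u l \<bullet> W) *\<^sub>R u l)"
  have proj: "orthogonal_proj (span (u ` {1..j})) W = p"
    unfolding p_def by (rule orthogonal_proj_span_orthonormal[OF uj]) simp
  have "{1..DIM('b)} = {1..j} \<union> {j<..DIM('b)}" using j by auto
  then have W: "W = p + N"
    unfolding p_def N_def
    by (subst orthonormal_on_expand[OF u, of W], subst sum.union_disjoint[symmetric]) auto
  have eN: "e i \<bullet> N = (if \<mu> i < \<tau> then e i \<bullet> W else 0)" if i: "i \<in> I" for i
  proof (cases "\<mu> i < \<tau>")
    case True
    have "u l \<bullet> e i = 0" if "l \<in> {1..j}" for l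
      using head[OF that] key[OF i, of l] True that j by fastforce
    then have "e i \<bullet> p = 0"
      unfolding p_def inner_sum_right by (intro sum.neutral) (simp add: inner_commute)
    then show ?thesis using True by (subst W) (simp add: inner_add_right)
  next
    case False
    have "u l \<bullet> e i = 0" if "l \<in> {j<..DIM('b)}" for l
      using tail[OF that] key[OF i, of l] False that j by fastforce
    then have "e i \<bullet> N = 0"
      unfolding N_def inner_sum_right by (intro sum.neutral) (simp add: inner_commute)
    then show ?thesis using False by simp
  qed
  have "(norm N)\<^sup>2 = (\<Sum>i\<in>I. (e i \<bullet> N)\<^sup>2)" by (rule pars)
  also have "\<dots> = (\<Sum>i\<in>{i\<in>I. \<mu> i < \<tau>}. (e i \<bullet> W)\<^sup>2)"
    using fin eN by (intro sum.mono_neutral_cong_right) auto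
  finally have "(norm N)\<^sup>2 = \<dots>" .
  moreover have "W - orthogonal_proj (span (u ` {1..j})) W = N"
    unfolding proj using W by (simp only: add_diff_cancel_left')
  ultimately show ?thesis using j by metis
qed

section \<open>Pairs of maps with common right singular vectors\<close>

lemma orthonormal_on_inner:
  fixes w :: "nat \<Rightarrow> 'a::euclidean_space"
  assumes "orthonormal_on {1..DIM('a)} w"
  shows "x \<bullet> y = (\<Sum>i = 1..DIM('a). (w i \<bullet> x) * (w i \<bullet> y))"
proof -
  have "x \<bullet> y = (\<Sum>i = 1..DIM('a). (w i \<bullet> x) *\<^sub>R w i) \<bullet> y"
    using orthonormal_on_expand[OF assms, of x] by simp
  then show ?thesis by (simp add: inner_sum_left)
qed

text \<open>A quantitative form of the equality of the kernels of \<open>A\<close> and \<open>B\<close>.\<close>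

lemma matched_norm_le:
  fixes A :: "'a::euclidean_space \<Rightarrow> 'b::euclidean_space" and B :: "'a \<Rightarrow> 'c::euclidean_space"
  assumes A: "is_svd A \<sigma> u v" and B: "is_svd B \<tau> w v"
    and k: "1 \<le> k" "k \<le> min DIM('a) DIM('b)" "k \<le> min DIM('a) DIM('c)"
    and z: "\<And>i. k < i \<Longrightarrow> \<tau> i = 0"
  shows "\<sigma> k * norm (B x) \<le> \<tau> 1 * norm (A x)"
proof -
  have \<sigma>: "0 \<le> \<sigma> k" "\<And>i. i \<in> {1..k} \<Longrightarrow> \<sigma> k \<le> \<sigma> i"
    and \<tau>: "0 \<le> \<tau> 1" "\<And>i. i \<in> {1..k} \<Longrightarrow> 0 \<le> \<tau> i" "\<And>i. i \<in> {1..k} \<Longrightarrow> \<tau> i \<le> \<tau> 1"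
    using A B k by (auto simp: is_svd_def)
  define S where "S = (\<Sum>i = 1..k. (v i \<bullet> x)\<^sup>2)"
  have "(norm (B x))\<^sup>2 = (\<Sum>i = 1..min DIM('a) DIM('c). (\<tau> i)\<^sup>2 * (v i \<bullet> x)\<^sup>2)"
    by (rule svd_norm[OF B])
  also have "\<dots> = (\<Sum>i = 1..k. (\<tau> i)\<^sup>2 * (v i \<bullet> x)\<^sup>2)"
    using k z by (intro sum.mono_neutral_right) auto
  also have "\<dots> \<le> (\<tau> 1)\<^sup>2 * S"
    unfolding S_def sum_distrib_left using \<tau>
    by (intro sum_mono mult_right_mono power_mono) auto
  finally have Bx: "(norm (B x))\<^sup>2 \<le> (\<tau> 1)\<^sup>2 * S" .
  have "(\<sigma> k)\<^sup>2 * S \<le> (\<Sum>i = 1..k. (\<sigma> i)\<^sup>2 * (v i \<bullet> x)\<^sup>2)"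
    unfolding S_def sum_distrib_left using \<sigma>
    by (intro sum_mono mult_right_mono power_mono) auto
  also have "\<dots> \<le> (\<Sum>i = 1..min DIM('a) DIM('b). (\<sigma> i)\<^sup>2 * (v i \<bullet> x)\<^sup>2)"
    using k by (intro sum_mono2) auto
  also have "\<dots> = (norm (A x))\<^sup>2" by (rule svd_norm[OF A, symmetric])
  finally have Ax: "(\<sigma> k)\<^sup>2 * S \<le> (norm (A x))\<^sup>2" .
  have "(\<sigma> k * norm (B x))\<^sup>2 \<le> (\<sigma> k)\<^sup>2 * ((\<tau> 1)\<^sup>2 * S)"
    unfolding power_mult_distrib using Bx by (intro mult_left_mono) auto
  also have "\<dots> = (\<tau> 1)\<^sup>2 * ((\<sigma> k)\<^sup>2 * S)" by simp
  also have "\<dots> \<le> (\<tau> 1 * norm (A x))\<^sup>2"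
    unfolding power_mult_distrib using Ax by (intro mult_left_mono) auto
  finally show ?thesis by (rule power2_le_imp_le) (use \<tau> in simp)
qed

text \<open>In terms of \<open>Z = A B\<^sup>T\<close> this says
  \<open>\<bar>a \<bullet> Z b\<bar> \<le> norm (Z\<^sup>T a) * norm (Z b) / (\<sigma>\<^sub>k \<tau>\<^sub>k)\<close>. Because the right singular vectors
  are shared, \<open>Z\<close> is diagonal in the left singular vectors of \<open>A\<close> and \<open>B\<close>, with nonzero entries
  \<open>\<sigma>\<^sub>i \<tau>\<^sub>i \<ge> \<sigma>\<^sub>k \<tau>\<^sub>k\<close>. The bound is what makes \<open>Z\<close> quadratically small on directions that \<open>Z\<close> almost
  annihilates from both sides.\<close>

lemma matched_bilinear_bound:
  fixes A :: "'a::euclidean_space \<Rightarrow> 'b::euclidean_space" and B :: "'a \<Rightarrow> 'c::euclidean_space"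
  assumes A: "is_svd A \<sigma> u v" and B: "is_svd B \<tau> w v"
    and k: "1 \<le> k" "k \<le> min DIM('a) DIM('b)" "k \<le> min DIM('a) DIM('c)"
    and zA: "\<And>i. k < i \<Longrightarrow> \<sigma> i = 0" and zB: "\<And>i. k < i \<Longrightarrow> \<tau> i = 0"
  shows "\<sigma> k * \<tau> k * \<bar>adjoint A a \<bullet> adjoint B b\<bar> \<le> norm (B (adjoint A a)) * norm (A (adjoint B b))"
proof -
  have v: "orthonormal_on {1..DIM('a)} v" using A by (simp add: is_svd_def)
  have pos: "0 \<le> \<sigma> k" "0 \<le> \<tau> k" and ge: "\<And>i. i \<in> {1..k} \<Longrightarrow> \<sigma> k \<le> \<sigma> i \<and> \<tau> k \<le> \<tau> i"
    using A B k by (auto simp: is_svd_def)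
  have vA: "v i \<bullet> adjoint A a = \<sigma> i * (u i \<bullet> a)" if "i \<in> {1..DIM('a)}" for i
    using svd_apply[OF A zA that] k by (simp add: adjoint_works[OF svd_linear[OF A]])
  have vB: "v i \<bullet> adjoint B b = \<tau> i * (w i \<bullet> b)" if "i \<in> {1..DIM('a)}" for i
    using svd_apply[OF B zB that] k by (simp add: adjoint_works[OF svd_linear[OF B]])
  define f where "f i = \<sigma> i * \<tau> i * (u i \<bullet> a)" for i
  define g where "g i = \<sigma> i * \<tau> i * (w i \<bullet> b)" for i
  have "(norm (B (adjoint A a)))\<^sup>2 = (\<Sum>i = 1..min DIM('a) DIM('c). (f i)\<^sup>2)"
    unfolding svd_norm[OF B] f_def by (intro sum.cong refl) (simp add: vA power_mult_distrib)
  also have "\<dots> = (\<Sum>i = 1..k. (f i)\<^sup>2)"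
    using k zA by (intro sum.mono_neutral_right) (auto simp: f_def)
  finally have nf: "norm (B (adjoint A a)) = L2_set f {1..k}"
    unfolding L2_set_def by (metis norm_ge_zero real_sqrt_abs abs_of_nonneg)
  have "(norm (A (adjoint B b)))\<^sup>2 = (\<Sum>i = 1..min DIM('a) DIM('b). (g i)\<^sup>2)"
    unfolding svd_norm[OF A] g_def by (intro sum.cong refl) (simp add: vB power_mult_distrib)
  also have "\<dots> = (\<Sum>i = 1..k. (g i)\<^sup>2)"
    using k zA by (intro sum.mono_neutral_right) (auto simp: g_def)
  finally have ng: "norm (A (adjoint B b)) = L2_set g {1..k}"
    unfolding L2_set_def by (metis norm_ge_zero real_sqrt_abs abs_of_nonneg)
  have "adjoint A a \<bullet> adjoint B b = (\<Sum>i = 1..DIM('a). \<sigma> i * \<tau> i * ((u i \<bullet> a) * (w i \<bullet> b)))"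
    unfolding orthonormal_on_inner[OF v, of "adjoint A a"]
    by (intro sum.cong refl) (simp add: vA vB)
  also have "\<dots> = (\<Sum>i = 1..k. \<sigma> i * \<tau> i * ((u i \<bullet> a) * (w i \<bullet> b)))"
    using k zA by (intro sum.mono_neutral_right) auto
  finally have "\<bar>adjoint A a \<bullet> adjoint B b\<bar> \<le> (\<Sum>i = 1..k. \<bar>\<sigma> i * \<tau> i * ((u i \<bullet> a) * (w i \<bullet> b))\<bar>)"
    by simp
  then have "\<sigma> k * \<tau> k * \<bar>adjoint A a \<bullet> adjoint B b\<bar>
      \<le> (\<Sum>i = 1..k. \<sigma> k * \<tau> k * \<bar>\<sigma> i * \<tau> i * ((u i \<bullet> a) * (w i \<bullet> b))\<bar>)"
    unfolding sum_distrib_left[symmetric] using pos by (intro mult_left_mono) auto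
  also have "\<dots> \<le> (\<Sum>i = 1..k. \<bar>f i\<bar> * \<bar>g i\<bar>)"
  proof (rule sum_mono)
    fix i assume "i \<in> {1..k}"
    then have "\<sigma> k * \<tau> k \<le> \<bar>\<sigma> i * \<tau> i\<bar>"
      using ge pos by (smt (verit, best) mult_mono)
    then have "\<sigma> k * \<tau> k * \<bar>\<sigma> i * \<tau> i * ((u i \<bullet> a) * (w i \<bullet> b))\<bar>
        \<le> \<bar>\<sigma> i * \<tau> i\<bar> * \<bar>\<sigma> i * \<tau> i * ((u i \<bullet> a) * (w i \<bullet> b))\<bar>"
      by (rule mult_right_mono) simp
    also have "\<dots> = \<bar>f i\<bar> * \<bar>g i\<bar>" by (simp add: f_def g_def abs_mult mult_ac)
    finally show "\<sigma> k * \<tau> k * \<bar>\<sigma> i * \<tau> i * ((u i \<bullet> a) * (w i \<bullet> b))\<bar> \<le> \<bar>f i\<bar> * \<bar>g i\<bar>" .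
  qed
  also have "\<dots> \<le> norm (B (adjoint A a)) * norm (A (adjoint B b))"
    unfolding nf ng by (rule L2_set_mult_ineq)
  finally show ?thesis .
qed

text \<open>If \<open>A\<close> and \<open>B\<close> are close to \<open>A\<^sub>0\<close> and \<open>B\<^sub>0\<close>, a trailing right singular vector \<open>x\<close> of \<open>A\<close> is
  almost in the kernel of \<open>A\<^sub>0\<close>, hence almost in the kernel of \<open>B\<^sub>0\<close>, because the two kernels agree.
  So \<open>B x\<close> is small as well, even though \<open>B\<close> may be large and \<open>x\<close> has nothing to do with its
  singular vectors.\<close>

lemma matched_trailing_bound:
  fixes A A\<^sub>0 :: "'a::euclidean_space \<Rightarrow> 'b::euclidean_space" and B B\<^sub>0 :: "'a \<Rightarrow> 'c::euclidean_space"
  assumes A0: "is_svd A\<^sub>0 \<sigma> u v" and B0: "is_svd B\<^sub>0 \<tau> w v"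
    and k: "1 \<le> k" "k \<le> min DIM('a) DIM('b)" "k \<le> min DIM('a) DIM('c)"
    and zA: "\<And>i. k < i \<Longrightarrow> \<sigma> i = 0" and zB: "\<And>i. k < i \<Longrightarrow> \<tau> i = 0"
    and A: "is_svd A \<alpha> a y" and z: "\<And>i. min DIM('a) DIM('b) < i \<Longrightarrow> \<alpha> i = 0"
    and dA: "\<And>x. norm (A x - A\<^sub>0 x) \<le> \<epsilon> * norm x" and dB: "\<And>x. norm (B x - B\<^sub>0 x) \<le> \<epsilon> * norm x"
    and B: "linear B"
    and M: "\<tau> 1 \<le> M" "\<sigma> k \<le> M" and \<epsilon>: "22 * M * \<epsilon> \<le> \<sigma> k * \<tau> k" and pos: "0 < \<sigma> k" "0 < \<tau> k"
    and i: "i \<in> {k<..DIM('b)}"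
  shows "norm (B (adjoint A (a i))) \<le> \<tau> k / 7 * \<alpha> i"
proof (cases "i \<le> min DIM('a) DIM('b)")
  case False
  then show ?thesis
    using svd_adjoint[OF A z, of i] z[of i] i linear_0[OF B] by simp
next
  case True
  then have i': "i \<in> {1..min DIM('a) DIM('b)}" using i by simp
  then have ia: "i \<in> {1..DIM('a)}" and ib: "i \<in> {1..DIM('b)}" by auto
  have a: "norm (a i) = 1" and y: "norm (y i) = 1" and \<alpha>: "0 \<le> \<alpha> i"
    using A i' by (auto simp: is_svd_def orthonormal_on_def norm_eq_1)
  have "\<alpha> i \<le> \<sigma> i + \<epsilon>"
    by (rule singular_value_perturbation[OF A A0 dA i'])
  then have \<alpha>\<epsilon>: "\<alpha> i \<le> \<epsilon>" using zA i by simp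
  have "A (y i) = \<alpha> i *\<^sub>R a i" by (rule svd_apply[OF A z ia])
  then have "norm (A (y i)) = \<alpha> i" using a \<alpha> by simp
  moreover have "norm (A\<^sub>0 (y i)) \<le> norm (A (y i)) + norm (A (y i) - A\<^sub>0 (y i))"
    by (metis norm_triangle_sub norm_minus_commute)
  ultimately have A0y: "norm (A\<^sub>0 (y i)) \<le> 2 * \<epsilon>"
    using dA[of "y i"] \<alpha>\<epsilon> y by simp
  have "\<sigma> k * norm (B\<^sub>0 (y i)) \<le> \<tau> 1 * norm (A\<^sub>0 (y i))"
    by (rule matched_norm_le[OF A0 B0 k zB])
  also have "\<dots> \<le> M * (2 * \<epsilon>)"
    using A0y M pos by (intro mult_mono) auto
  finally have B0y: "\<sigma> k * norm (B\<^sub>0 (y i)) \<le> M * (2 * \<epsilon>)" .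
  have "norm (B (y i)) \<le> norm (B\<^sub>0 (y i)) + norm (B (y i) - B\<^sub>0 (y i))"
    by (metis norm_triangle_sub)
  then have "norm (B (y i)) \<le> norm (B\<^sub>0 (y i)) + \<epsilon>"
    using dB[of "y i"] y by simp
  then have "\<sigma> k * norm (B (y i)) \<le> \<sigma> k * norm (B\<^sub>0 (y i)) + \<sigma> k * \<epsilon>"
    using pos by (simp add: distrib_left[symmetric])
  also have "\<sigma> k * \<epsilon> \<le> M * \<epsilon>"
    using M \<alpha> \<alpha>\<epsilon> by (intro mult_right_mono) auto
  finally have "\<sigma> k * norm (B (y i)) \<le> 3 * (M * \<epsilon>)" using B0y by simp
  also have "\<dots> \<le> \<sigma> k * (\<tau> k / 7)"
    using \<epsilon> mult_pos_pos[OF pos] by simp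
  finally have "norm (B (y i)) \<le> \<tau> k / 7" using pos by simp
  moreover have "adjoint A (a i) = \<alpha> i *\<^sub>R y i" by (rule svd_adjoint[OF A z ib])
  ultimately show ?thesis
    using mult_left_mono[OF _ \<alpha>, of "norm (B (y i))" "\<tau> k / 7"] \<alpha>
    by (simp add: linear_scale[OF B] mult.commute)
qed

section \<open>Matrices with the Frobenius norm\<close>

lemma norm_sq_rows: "(norm (A :: real^'n^'m))\<^sup>2 = (\<Sum>i\<in>UNIV. (norm (A $ i))\<^sup>2)"
  by (simp add: power2_norm_eq_inner inner_vec_def)

lemma norm_sq_matrix_vector_mult: "(norm ((A :: real^'n^'m) *v x))\<^sup>2 = (\<Sum>i\<in>UNIV. (A $ i \<bullet> x)\<^sup>2)"
  unfolding power2_norm_eq_inner inner_vec_def[of "A *v x"] matrix_vector_mul_component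
  by (simp only: inner_real_def power2_eq_square)

lemma norm_matrix_vector_mult_le: "norm ((A :: real^'n^'m) *v x) \<le> norm A * norm x"
proof -
  have "(norm (A *v x))\<^sup>2 = (\<Sum>i\<in>UNIV. (A $ i \<bullet> x)\<^sup>2)"
    by (rule norm_sq_matrix_vector_mult)
  also have "\<dots> \<le> (\<Sum>i\<in>UNIV. (norm (A $ i))\<^sup>2 * (norm x)\<^sup>2)"
  proof (rule sum_mono)
    fix i
    show "(A $ i \<bullet> x)\<^sup>2 \<le> (norm (A $ i))\<^sup>2 * (norm x)\<^sup>2"
      using power_mono[OF Cauchy_Schwarz_ineq2[of "A $ i" x] abs_ge_zero, of 2]
      by (simp add: power_mult_distrib)
  qed
  also have "\<dots> = (norm A * norm x)\<^sup>2"
    by (simp add: norm_sq_rows power_mult_distrib sum_distrib_right)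
  finally show ?thesis by (rule power2_le_imp_le) simp
qed

lemma norm_transpose: "norm (transpose A) = norm (A :: real^'n^'m)"
proof -
  have "(norm (transpose A))\<^sup>2 = (norm A)\<^sup>2"
    by (simp add: norm_sq_rows power2_norm_eq_inner inner_vec_def transpose_def) (rule sum.swap)
  then show ?thesis by simp
qed

lemma norm_vector_matrix_mult_le: "norm (x v* (A :: real^'n^'m)) \<le> norm x * norm A"
  using norm_matrix_vector_mult_le[of "transpose A" x] by (simp add: norm_transpose mult.commute)

lemma norm_matrix_mult_le: "norm ((A :: real^'n^'m) ** (B :: real^'k^'n)) \<le> norm A * norm B"
proof -
  have row: "(A ** B) $ i = A $ i v* B" for i
    by (simp add: vec_eq_iff matrix_matrix_mult_def vector_matrix_mult_def mult.commute)
  have "(norm (A ** B))\<^sup>2 \<le> (\<Sum>i\<in>UNIV. (norm (A $ i) * norm B)\<^sup>2)"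
    unfolding norm_sq_rows[of "A ** B"] row
    by (intro sum_mono power_mono norm_vector_matrix_mult_le) simp
  also have "\<dots> = (norm A * norm B)\<^sup>2"
    by (simp add: norm_sq_rows[of A] power_mult_distrib sum_distrib_right)
  finally show ?thesis by (rule power2_le_imp_le) simp
qed

lemma DIM_real_vec: "DIM(real^'n) = CARD('n)"
  by simp

lemma norm_sq_matrix_columns:
  fixes M :: "real^'n^'m"
  assumes b: "orthonormal_on {1..CARD('n)} b"
  shows "(norm M)\<^sup>2 = (\<Sum>k = 1..CARD('n). (norm (M *v b k))\<^sup>2)"
proof -
  have "(norm M)\<^sup>2 = (\<Sum>i\<in>UNIV. \<Sum>k = 1..CARD('n). (b k \<bullet> M $ i)\<^sup>2)"
    using orthonormal_on_parseval[of b] b unfolding norm_sq_rows DIM_real_vec by simp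
  also have "\<dots> = (\<Sum>k = 1..CARD('n). \<Sum>i\<in>UNIV. (b k \<bullet> M $ i)\<^sup>2)"
    by (rule sum.swap)
  also have "\<dots> = (\<Sum>k = 1..CARD('n). (norm (M *v b k))\<^sup>2)"
    by (simp only: norm_sq_matrix_vector_mult inner_commute)
  finally show ?thesis .
qed

lemma norm_sq_matrix_rows:
  fixes M :: "real^'n^'m"
  assumes "orthonormal_on {1..CARD('m)} a"
  shows "(norm M)\<^sup>2 = (\<Sum>k = 1..CARD('m). (norm (a k v* M))\<^sup>2)"
  using norm_sq_matrix_columns[OF assms, of "transpose M"] by (simp add: norm_transpose)

definition outer :: "real^'m \<Rightarrow> real^'n \<Rightarrow> real^'n^'m" where
  "outer a b = (\<chi> i j. a $ i * b $ j)"

lemma inner_outer: "outer a b \<bullet> M = a \<bullet> (M *v b)"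
  by (simp add: outer_def inner_vec_def matrix_vector_mult_def sum_distrib_left mult_ac)

lemma outer_matrix_mult: "outer a b ** M = outer a (b v* M)"
  by (simp add: outer_def vec_eq_iff matrix_matrix_mult_def vector_matrix_mult_def sum_distrib_left mult_ac)

lemma matrix_mult_outer: "M ** outer a b = outer (M *v a) b"
  by (simp add: outer_def vec_eq_iff matrix_matrix_mult_def matrix_vector_mult_def sum_distrib_left mult_ac)

lemma transpose_outer: "transpose (outer a b) = outer b a"
  by (simp add: outer_def vec_eq_iff transpose_def mult.commute)

lemma outer_scaleR: "outer (c *\<^sub>R a) b = c *\<^sub>R outer a b" "outer a (c *\<^sub>R b) = c *\<^sub>R outer a b"
  by (simp_all add: outer_def vec_eq_iff mult_ac)

lemma norm_sq_outer_basis: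
  fixes M :: "real^'n^'m"
  assumes a: "orthonormal_on {1..CARD('m)} a" and b: "orthonormal_on {1..CARD('n)} b"
  shows "(norm M)\<^sup>2 = (\<Sum>(i,k)\<in>{1..CARD('m)} \<times> {1..CARD('n)}. (outer (a i) (b k) \<bullet> M)\<^sup>2)"
proof -
  have "(norm M)\<^sup>2 = (\<Sum>k = 1..CARD('n). \<Sum>i = 1..CARD('m). (outer (a i) (b k) \<bullet> M)\<^sup>2)"
    using orthonormal_on_parseval[of a] a
    unfolding norm_sq_matrix_columns[OF b] inner_outer DIM_real_vec by simp
  also have "\<dots> = (\<Sum>i = 1..CARD('m). \<Sum>k = 1..CARD('n). (outer (a i) (b k) \<bullet> M)\<^sup>2)"
    by (rule sum.swap)
  finally show ?thesis by (simp add: sum.cartesian_product)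
qed

section \<open>The derivative of the factorization map\<close>

lemma frechet_derivative_F_asym:
  "frechet_derivative F_asym (at (X :: real^'r^'m, Y :: real^'r^'n))
    = (\<lambda>(H, K). H ** transpose Y + X ** transpose K)"
proof -
  interpret bounded_bilinear "\<lambda>(X :: real^'r^'m) (Y :: real^'r^'n). X ** transpose Y"
  proof
    show "\<exists>K. \<forall>(a :: real^'r^'m) (b :: real^'r^'n). norm (a ** transpose b) \<le> norm a * norm b * K"
      by (metis norm_matrix_mult_le norm_transpose mult.right_neutral)
  qed (simp_all add: vec_eq_iff matrix_matrix_mult_def transpose_def algebra_simps
        sum.distrib sum_distrib_left)
  have "((\<lambda>x. fst x ** transpose (snd x)) has_derivative
      (\<lambda>h. fst (X, Y) ** transpose (snd h) + fst h ** transpose (snd (X, Y)))) (at (X, Y))"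
    by (intro FDERIV has_derivative_fst has_derivative_snd has_derivative_ident)
  then have "(F_asym has_derivative (\<lambda>(H, K). H ** transpose Y + X ** transpose K)) (at (X, Y))"
    by (simp add: F_asym_def case_prod_unfold add.commute)
  then show ?thesis by (rule frechet_derivative_at[symmetric])
qed

lemma onorm_frechet_derivative_F_asym_diff:
  fixes X X' :: "real^'r^'m" and Y Y' :: "real^'r^'n"
  shows "onorm (\<lambda>H. frechet_derivative F_asym (at (X, Y)) H - frechet_derivative F_asym (at (X', Y')) H)
    \<le> norm ((X, Y) - (X', Y'))"
proof (rule onorm_le)
  fix Z :: "(real^'r^'m) \<times> (real^'r^'n)"
  obtain H K where Z: "Z = (H, K)" by (cases Z)
  define DX where "DX = X - X'"
  define DY where "DY = Y - Y'"
  have "frechet_derivative F_asym (at (X, Y)) Z - frechet_derivative F_asym (at (X', Y')) Z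
      = H ** transpose DY + DX ** transpose K"
    unfolding frechet_derivative_F_asym Z DX_def DY_def
    by (simp add: vec_eq_iff matrix_matrix_mult_def transpose_def algebra_simps sum_subtractf)
  also have "norm \<dots> \<le> norm H * norm DY + norm DX * norm K"
    using norm_triangle_ineq[of "H ** transpose DY" "DX ** transpose K"]
      norm_matrix_mult_le[of H "transpose DY"] norm_matrix_mult_le[of DX "transpose K"]
    by (simp add: norm_transpose)
  also have "\<dots> = (norm DX, norm DY) \<bullet> (norm K, norm H)" by (simp add: mult.commute)
  also have "\<dots> \<le> norm (norm DX, norm DY) * norm (norm K, norm H)"
    by (rule norm_cauchy_schwarz)
  also have "\<dots> = norm ((X, Y) - (X', Y')) * norm Z"
    by (simp add: norm_Pair Z DX_def DY_def add.commute)
  finally show "norm (frechet_derivative F_asym (at (X, Y)) Z - frechet_derivative F_asym (at (X', Y')) Z)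
      \<le> norm ((X, Y) - (X', Y')) * norm Z" .
qed

lemma adjoint_matrix_vector_mult: "adjoint ((*v) (A :: real^'n^'m)) a = a v* A"
  using adjoint_matrix[of A] by simp

lemma F_asym_derivative_adjoint_outer:
  fixes X :: "real^'r^'m" and Y :: "real^'r^'n"
  shows "adjoint (frechet_derivative F_asym (at (X, Y))) (outer a b) = (outer a (b v* Y), outer b (a v* X))"
proof (rule vector_eq_rdot[THEN iffD1], rule allI)
  fix Z :: "(real^'r^'m) \<times> (real^'r^'n)"
  obtain H K where Z: "Z = (H, K)" by (cases Z)
  have lin: "linear (\<lambda>(H, K). H ** transpose Y + X ** transpose K)"
    by (rule linearI) (auto simp: transpose_def vec_eq_iff matrix_matrix_mult_def algebra_simps
        sum.distrib sum_distrib_left)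
  have "a \<bullet> ((X ** transpose K) *v b) = b \<bullet> (K *v (a v* X))"
    by (simp add: dot_lmul_matrix[symmetric] matrix_vector_mul_assoc[symmetric] inner_commute)
  then have "outer a b \<bullet> (H ** transpose Y + X ** transpose K) = (outer a (b v* Y), outer b (a v* X)) \<bullet> Z"
    by (simp add: Z inner_outer inner_add_right matrix_vector_mult_add_rdistrib
        matrix_vector_mul_assoc[symmetric])
  moreover have "adjoint (\<lambda>(H, K). H ** transpose Y + X ** transpose K) (outer a b) \<bullet> Z
      = outer a b \<bullet> (H ** transpose Y + X ** transpose K)"
    using adjoint_works[OF lin, of Z "outer a b"] by (simp add: Z inner_commute)
  ultimately show "adjoint (frechet_derivative F_asym (at (X, Y))) (outer a b) \<bullet> Z
      = (outer a (b v* Y), outer b (a v* X)) \<bullet> Z"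
    unfolding frechet_derivative_F_asym by simp
qed

text \<open>The derivative composed with its adjoint is \<open>W \<mapsto> X X\<^sup>T W + W Y Y\<^sup>T\<close>, so the products of left singular vectors
  of \<open>X\<close> and \<open>Y\<close> diagonalise it.\<close>

lemma F_asym_derivative_eigen:
  fixes X :: "real^'r^'m" and Y :: "real^'r^'n"
  assumes "X *v (a v* X) = p *\<^sub>R a" "Y *v (b v* Y) = q *\<^sub>R b"
  shows "frechet_derivative F_asym (at (X, Y))
      (adjoint (frechet_derivative F_asym (at (X, Y))) (outer a b)) = (p + q) *\<^sub>R outer a b"
  unfolding F_asym_derivative_adjoint_outer
  unfolding frechet_derivative_F_asym
  by (simp add: outer_matrix_mult matrix_mult_outer transpose_outer assms outer_scaleR algebra_simps)

section \<open>Local weak alignment\<close>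

lemma power2_sum_le: "(x + y :: real)\<^sup>2 \<le> 2 * x\<^sup>2 + 2 * y\<^sup>2"
  using zero_le_power2[of "x - y"] by (simp add: power2_sum power2_diff)

text \<open>The arithmetic of the final estimate. Here \<open>w\<close> is the norm of the residual, \<open>p\<close> and \<open>q\<close> are the
  least nonzero singular values of the two factors, \<open>m = min p\<^sup>2 q\<^sup>2\<close>, and \<open>T\<close> bounds the total
  weight of the trailing squared singular values. The term \<open>8 w\<^sup>4 / (p q)\<^sup>2\<close> uses up half of the
  available \<open>(\<rho> w)\<^sup>2\<close>; the others are much smaller.\<close>

lemma trailing_block_arith:
  fixes p q m w T \<rho> :: real
  assumes pos: "0 < m" "0 \<le> w" "0 \<le> T" "0 < \<rho>" "0 < p" "0 < q"
    and m: "m \<le> p\<^sup>2" "m \<le> q\<^sup>2" and w: "w \<le> \<rho> / 4 * m" and T: "T \<le> \<rho> * w / 28"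
  shows "2 * T\<^sup>2 + 8 * (q\<^sup>2 / 49 * T + w\<^sup>2) * (p\<^sup>2 / 49 * T + w\<^sup>2) / (p * q)\<^sup>2 \<le> (\<rho> * w)\<^sup>2"
proof -
  define P where "P = p\<^sup>2"
  define Q where "Q = q\<^sup>2"
  have PQ: "0 < P" "0 < Q" "m \<le> P" "m \<le> Q" using pos m by (auto simp: P_def Q_def)
  define R where "R = \<rho> * w"
  have R: "0 \<le> R" using pos by (simp add: R_def)
  have wm: "w / m \<le> \<rho> / 4" using w pos by (simp add: field_simps)
  have Tm: "T / m \<le> \<rho>\<^sup>2 / 112"
  proof -
    have "T / m \<le> \<rho> * w / 28 / m" using T pos by (intro divide_right_mono) auto
    also have "\<dots> = \<rho> / 28 * (w / m)" by simp
    also have "\<dots> \<le> \<rho> / 28 * (\<rho> / 4)" using wm pos by (intro mult_left_mono) auto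
    finally show ?thesis by (simp add: power2_eq_square)
  qed
  have T2: "T\<^sup>2 \<le> R\<^sup>2 / 784"
  proof -
    have "T\<^sup>2 \<le> (R / 28)\<^sup>2" using T pos by (intro power_mono) (auto simp: R_def)
    then show ?thesis by (simp add: power_divide)
  qed
  have TP: "T * w\<^sup>2 / S \<le> R\<^sup>2 / 112" if "m \<le> S" for S
  proof -
    have "T * w\<^sup>2 / S \<le> T * w\<^sup>2 / m" using that pos by (intro divide_left_mono) auto
    also have "\<dots> = (T / m) * w\<^sup>2" by simp
    also have "\<dots> \<le> \<rho>\<^sup>2 / 112 * w\<^sup>2" using Tm by (intro mult_right_mono) auto
    finally show ?thesis by (simp add: R_def power_mult_distrib)
  qed
  have w4: "w\<^sup>2 * w\<^sup>2 / (P * Q) \<le> R\<^sup>2 / 16"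
  proof -
    have "w\<^sup>2 * w\<^sup>2 / (P * Q) \<le> w\<^sup>2 * w\<^sup>2 / (m * m)"
      using PQ pos by (intro divide_left_mono mult_mono) auto
    also have "\<dots> = w\<^sup>2 * (w / m)\<^sup>2" by (simp add: power_divide power2_eq_square)
    also have "\<dots> \<le> w\<^sup>2 * (\<rho> / 4)\<^sup>2"
      using wm pos by (intro mult_left_mono power_mono) auto
    finally show ?thesis by (simp add: R_def power_mult_distrib power_divide mult.commute)
  qed
  define E where "E = (Q / 49 * T + w\<^sup>2) * (P / 49 * T + w\<^sup>2) / (P * Q)"
  define x where "x = T * w\<^sup>2 / P"
  define y where "y = T * w\<^sup>2 / Q"
  define z where "z = w\<^sup>2 * w\<^sup>2 / (P * Q)"
  have E8: "8 * (q\<^sup>2 / 49 * T + w\<^sup>2) * (p\<^sup>2 / 49 * T + w\<^sup>2) / (p * q)\<^sup>2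
      = 8 * E"
    by (simp add: E_def P_def Q_def power_mult_distrib)
  have "E = T\<^sup>2 / 2401 + x / 49 + y / 49 + z"
    using PQ unfolding E_def x_def y_def z_def by (simp add: field_simps power2_eq_square)
  moreover have "x \<le> R\<^sup>2 / 112" "y \<le> R\<^sup>2 / 112" "z \<le> R\<^sup>2 / 16"
    unfolding x_def y_def z_def using TP PQ w4 by auto
  ultimately have "2 * T\<^sup>2 + 8 * E \<le> R\<^sup>2"
    using T2 zero_le_power2[of R] by linarith
  then show ?thesis using E8 unfolding R_def by simp
qed

lemma sum_product_bound:
  fixes f g :: "nat \<Rightarrow> real"
  assumes "\<And>i. 0 \<le> f i" "\<And>i. 0 \<le> g i" "sum f A \<le> a" "sum g B \<le> b"
  shows "(\<Sum>i\<in>A. \<Sum>k\<in>B. f i * g k) \<le> a * b"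
proof -
  have "(\<Sum>i\<in>A. \<Sum>k\<in>B. f i * g k) = sum f A * sum g B" by (simp add: sum_product)
  also have "\<dots> \<le> a * b"
    using assms by (intro mult_mono sum_nonneg order_trans[OF sum_nonneg assms(3)]) auto
  finally show ?thesis .
qed

text \<open>In the application \<open>t i k\<close> is the coefficient of the residual on the product of the \<open>i\<close>-th left
  singular vector of \<open>X\<close> and the \<open>k\<close>-th of \<open>Y\<close>. Every summand of its bound is a product of a function
  of \<open>i\<close> and a function of \<open>k\<close>, so the sums of squares over the block factor.\<close>

lemma trailing_block_bound:
  fixes \<alpha> \<beta> f g :: "nat \<Rightarrow> real" and t :: "nat \<Rightarrow> nat \<Rightarrow> real"
  assumes pos: "0 < m" "0 \<le> w" "0 \<le> T" "0 < \<rho>" "0 < p" "0 < q"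
    and m: "m \<le> p\<^sup>2" "m \<le> q\<^sup>2" and w: "w \<le> \<rho> / 4 * m" and T: "T \<le> \<rho> * w / 28"
    and \<alpha>: "(\<Sum>i\<in>A. (\<alpha> i)\<^sup>2) \<le> T" and \<beta>: "(\<Sum>k\<in>B. (\<beta> k)\<^sup>2) \<le> T"
    and f: "(\<Sum>i\<in>A. (f i)\<^sup>2) \<le> w\<^sup>2" and g: "(\<Sum>k\<in>B. (g k)\<^sup>2) \<le> w\<^sup>2"
    and t: "\<And>i k. i \<in> A \<Longrightarrow> k \<in> B \<Longrightarrow>
      \<bar>t i k\<bar> \<le> \<alpha> i * \<beta> k + (q / 7 * \<alpha> i + f i) * (p / 7 * \<beta> k + g k) / (p * q)"
  shows "(\<Sum>i\<in>A. \<Sum>k\<in>B. (t i k)\<^sup>2) \<le> (\<rho> * w)\<^sup>2"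
proof -
  define F where "F i = 2 * (q\<^sup>2 / 49 * (\<alpha> i)\<^sup>2) + 2 * (f i)\<^sup>2" for i
  define G where "G k = 2 * (p\<^sup>2 / 49 * (\<beta> k)\<^sup>2) + 2 * (g k)\<^sup>2" for k
  have Fle: "(q / 7 * \<alpha> i + f i)\<^sup>2 \<le> F i" for i
    using power2_sum_le[of "q / 7 * \<alpha> i" "f i"] by (simp add: F_def power_mult_distrib power_divide)
  have Gle: "(p / 7 * \<beta> k + g k)\<^sup>2 \<le> G k" for k
    using power2_sum_le[of "p / 7 * \<beta> k" "g k"] by (simp add: G_def power_mult_distrib power_divide)
  have FG0: "0 \<le> F i" "0 \<le> G i" for i by (auto simp: F_def G_def)
  have t2: "(t i k)\<^sup>2 \<le> 2 * ((\<alpha> i)\<^sup>2 * (\<beta> k)\<^sup>2) + 2 / (p * q)\<^sup>2 * (F i * G k)" if "i \<in> A" "k \<in> B" for i k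
  proof -
    have "(t i k)\<^sup>2 \<le> (\<alpha> i * \<beta> k + (q / 7 * \<alpha> i + f i) * (p / 7 * \<beta> k + g k) / (p * q))\<^sup>2"
      using power_mono[OF t[OF that] abs_ge_zero, of 2] by simp
    also have "\<dots> \<le> 2 * (\<alpha> i * \<beta> k)\<^sup>2 + 2 * ((q / 7 * \<alpha> i + f i) * (p / 7 * \<beta> k + g k) / (p * q))\<^sup>2"
      by (rule power2_sum_le)
    also have "\<dots> = 2 * ((\<alpha> i)\<^sup>2 * (\<beta> k)\<^sup>2)
        + 2 / (p * q)\<^sup>2 * ((q / 7 * \<alpha> i + f i)\<^sup>2 * (p / 7 * \<beta> k + g k)\<^sup>2)"
      by (simp only: power_mult_distrib power_divide times_divide_eq_left times_divide_eq_right)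
    also have "\<dots> \<le> 2 * ((\<alpha> i)\<^sup>2 * (\<beta> k)\<^sup>2) + 2 / (p * q)\<^sup>2 * (F i * G k)"
      using Fle Gle FG0 by (intro add_left_mono mult_left_mono mult_mono) auto
    finally show ?thesis .
  qed
  have "(\<Sum>i\<in>A. \<Sum>k\<in>B. (t i k)\<^sup>2)
      \<le> (\<Sum>i\<in>A. \<Sum>k\<in>B. 2 * ((\<alpha> i)\<^sup>2 * (\<beta> k)\<^sup>2) + 2 / (p * q)\<^sup>2 * (F i * G k))"
    by (intro sum_mono t2)
  also have "\<dots> = 2 * (\<Sum>i\<in>A. \<Sum>k\<in>B. (\<alpha> i)\<^sup>2 * (\<beta> k)\<^sup>2) + 2 / (p * q)\<^sup>2 * (\<Sum>i\<in>A. \<Sum>k\<in>B. F i * G k)"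
    by (simp only: sum.distrib sum_distrib_left)
  also have "\<dots> \<le> 2 * (T * T)
      + 2 / (p * q)\<^sup>2 * ((2 * (q\<^sup>2 / 49 * T) + 2 * w\<^sup>2) * (2 * (p\<^sup>2 / 49 * T) + 2 * w\<^sup>2))"
  proof (intro add_mono mult_left_mono sum_product_bound FG0 \<alpha> \<beta>)
    show "sum F A \<le> 2 * (q\<^sup>2 / 49 * T) + 2 * w\<^sup>2"
      unfolding F_def sum.distrib sum_distrib_left[symmetric]
      using \<alpha> f by (intro add_mono mult_left_mono) auto
    show "sum G B \<le> 2 * (p\<^sup>2 / 49 * T) + 2 * w\<^sup>2"
      unfolding G_def sum.distrib sum_distrib_left[symmetric]
      using \<beta> g by (intro add_mono mult_left_mono) auto
  qed auto
  also have "\<dots> = 2 * T\<^sup>2 + 8 * (q\<^sup>2 / 49 * T + w\<^sup>2) * (p\<^sup>2 / 49 * T + w\<^sup>2) / (p * q)\<^sup>2"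
    by (simp add: algebra_simps power2_eq_square add_divide_distrib)
  also have "\<dots> \<le> (\<rho> * w)\<^sup>2"
    by (rule trailing_block_arith[OF pos m w T])
  finally show ?thesis .
qed

text \<open>Only the indices up to \<open>n\<close> contribute. With \<open>n\<close> the number of columns and \<open>k\<close> the rank of the
  reference factor, this is how the excess rank enters the estimate.\<close>

lemma sum_small_squares_le:
  fixes \<alpha> :: "nat \<Rightarrow> real"
  assumes "\<And>i. n < i \<Longrightarrow> \<alpha> i = 0" "0 \<le> \<tau>" "k \<le> n"
  shows "(\<Sum>i\<in>{i\<in>{k<..d}. (\<alpha> i)\<^sup>2 < \<tau>}. (\<alpha> i)\<^sup>2) \<le> (real n - real k) * \<tau>"
proof -
  let ?S = "{i\<in>{k<..d}. (\<alpha> i)\<^sup>2 < \<tau>}"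
  have "(\<Sum>i\<in>?S. (\<alpha> i)\<^sup>2) = (\<Sum>i\<in>?S \<inter> {k<..n}. (\<alpha> i)\<^sup>2)"
    using assms(1) by (intro sum.mono_neutral_right) force+
  also have "\<dots> \<le> real (card (?S \<inter> {k<..n})) * \<tau>"
    by (rule sum_bounded_above) auto
  also have "\<dots> \<le> (real n - real k) * \<tau>"
  proof (rule mult_right_mono)
    have "card (?S \<inter> {k<..n}) \<le> card {k<..n}" by (intro card_mono) auto
    then show "real (card (?S \<inter> {k<..n})) \<le> real n - real k" using assms(3) by simp
  qed (rule assms(2))
  finally show ?thesis .
qed

text \<open>The alignment at one point, for a free threshold \<open>\<tau>\<close>. By Weyl's inequality the first \<open>k\<close> singular
  values of \<open>X\<close> and \<open>Y\<close> have squares at least \<open>\<tau>\<close>, so the part of \<open>W\<close> below the threshold lives on pairs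
  of trailing left singular vectors. On such a pair \<open>(a, b)\<close> with singular values \<open>\<alpha>\<close>, \<open>\<beta>\<close>, the
  coefficient of \<open>X Y\<^sup>T\<close> is at most \<open>\<alpha> \<beta>\<close>. The coefficient of the reference matrix is controlled by its
  action on \<open>a\<close> and on \<open>b\<close> separately, and each of these is the corresponding action of \<open>X Y\<^sup>T\<close>, which
  the trailing bound makes small, up to that of \<open>W\<close>.\<close>

lemma F_asym_alignment_at:
  fixes X Xs :: "real^'r^'m" and Y Ys :: "real^'r^'n"
  assumes SX: "is_svd ((*v) Xs) \<sigma>X uX v" and SY: "is_svd ((*v) Ys) \<sigma>Y uY v"
    and k: "1 \<le> k" "k \<le> min CARD('r) CARD('m)" "k \<le> min CARD('r) CARD('n)"
    and zX: "\<And>i. k < i \<Longrightarrow> \<sigma>X i = 0" and zY: "\<And>i. k < i \<Longrightarrow> \<sigma>Y i = 0"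
    and pos: "0 < \<sigma>X k" "0 < \<sigma>Y k" "0 < m" "0 < \<tau>" "0 < \<rho>"
    and m: "m \<le> (\<sigma>X k)\<^sup>2" "m \<le> (\<sigma>Y k)\<^sup>2"
    and M: "\<sigma>X 1 \<le> M" "\<sigma>Y 1 \<le> M" and \<epsilon>: "22 * M * \<epsilon> \<le> m"
    and X: "norm (X - Xs) \<le> \<epsilon>" and Y: "norm (Y - Ys) \<le> \<epsilon>"
    and D: "is_svd (frechet_derivative F_asym (at (X, Y))) S U V"
    and W: "W = X ** transpose Y - Xs ** transpose Ys"
    and w: "norm W \<le> \<rho> / 4 * m"
    and \<tau>: "\<tau> \<le> m / 4" "(real CARD('r) - real k) * \<tau> \<le> \<rho> * norm W / 28"
  shows "\<exists>j\<in>{1..min DIM((real^'r^'m) \<times> (real^'r^'n)) DIM(real^'n^'m)}. \<tau> \<le> (S j)\<^sup>2 \<and>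
    norm (W - orthogonal_proj (span (U ` {1..j})) W) \<le> \<rho> * norm W"
proof -
  define p where "p = \<sigma>X k"
  define q where "q = \<sigma>Y k"
  have pq: "0 < p" "0 < q" using pos by (auto simp: p_def q_def)
  note dimk = k[folded DIM_real_vec]
  have pM: "p \<le> M" and qM: "q \<le> M"
    using svd_mono[OF SX order_refl dimk(1,2)] svd_mono[OF SY order_refl dimk(1,3)] M
    by (simp_all add: p_def q_def)
  have \<epsilon>0: "0 \<le> \<epsilon>" using X norm_ge_zero[of "X - Xs"] by linarith
  have half: "\<epsilon> \<le> s / 2" if s: "m \<le> s\<^sup>2" "0 < s" "s \<le> M" for s
  proof -
    have "22 * s * \<epsilon> \<le> 22 * M * \<epsilon>"
      using s \<epsilon>0 by (intro mult_right_mono) auto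
    also have "\<dots> \<le> s * s" using \<epsilon> s by (simp add: power2_eq_square)
    finally have "s * (22 * \<epsilon>) \<le> s * s" by simp
    then have "22 * \<epsilon> \<le> s" by (rule mult_left_le_imp_le) (rule s(2))
    then show ?thesis using \<epsilon>0 by simp
  qed
  have mpq: "m \<le> p * q"
  proof (cases "p \<le> q")
    case True
    then have "p\<^sup>2 \<le> p * q" using pq by (simp add: power2_eq_square)
    then show ?thesis using m by (simp add: p_def)
  next
    case False
    then have "q\<^sup>2 \<le> p * q" using pq by (simp add: power2_eq_square)
    then show ?thesis using m by (simp add: q_def)
  qed
  have dX: "norm (X *v x - Xs *v x) \<le> \<epsilon> * norm x" for x
    using norm_matrix_vector_mult_le[of "X - Xs" x] mult_right_mono[OF X norm_ge_zero[of x]]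
    by (simp add: matrix_vector_mult_diff_rdistrib)
  have dY: "norm (Y *v x - Ys *v x) \<le> \<epsilon> * norm x" for x
    using norm_matrix_vector_mult_le[of "Y - Ys" x] mult_right_mono[OF Y norm_ge_zero[of x]]
    by (simp add: matrix_vector_mult_diff_rdistrib)
  have dX': "norm (Xs *v x - X *v x) \<le> \<epsilon> * norm x" for x
    using dX[of x] by (simp add: norm_minus_commute)
  have dY': "norm (Ys *v x - Y *v x) \<le> \<epsilon> * norm x" for x
    using dY[of x] by (simp add: norm_minus_commute)
  obtain \<alpha> a y where A: "is_svd ((*v) X) \<alpha> a y"
    and \<alpha>0: "\<And>i. min DIM(real^'r) DIM(real^'m) < i \<Longrightarrow> \<alpha> i = 0"
    using svd_exists[OF matrix_vector_mul_linear[of X]] by blast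
  obtain \<beta> b z where B: "is_svd ((*v) Y) \<beta> b z"
    and \<beta>0: "\<And>i. min DIM(real^'r) DIM(real^'n) < i \<Longrightarrow> \<beta> i = 0"
    using svd_exists[OF matrix_vector_mul_linear[of Y]] by blast
  have a: "orthonormal_on {1..CARD('m)} a" and b: "orthonormal_on {1..CARD('n)} b"
    using A B by (auto simp: is_svd_def)
  \<comment> \<open>The leading singular values stay above half of those of the reference factors.\<close>
  have lead\<alpha>: "\<tau> \<le> (\<alpha> i)\<^sup>2" if i: "i \<in> {1..k}" for i
  proof -
    have i': "i \<in> {1..min DIM(real^'r) DIM(real^'m)}" using i dimk by auto
    have "\<sigma>X i \<le> \<alpha> i + \<epsilon>" by (rule singular_value_perturbation[OF SX A dX' i'])
    moreover have "p \<le> \<sigma>X i" using SX i dimk by (auto simp: p_def is_svd_def)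
    ultimately have "p / 2 \<le> \<alpha> i" using half[OF m(1)] pM pos by (simp add: p_def)
    then have "(p / 2)\<^sup>2 \<le> (\<alpha> i)\<^sup>2" using pq by (intro power_mono) auto
    then show ?thesis using m \<tau> by (simp add: p_def power_divide)
  qed
  have lead\<beta>: "\<tau> \<le> (\<beta> i)\<^sup>2" if i: "i \<in> {1..k}" for i
  proof -
    have i': "i \<in> {1..min DIM(real^'r) DIM(real^'n)}" using i dimk by auto
    have "\<sigma>Y i \<le> \<beta> i + \<epsilon>" by (rule singular_value_perturbation[OF SY B dY' i'])
    moreover have "q \<le> \<sigma>Y i" using SY i dimk by (auto simp: q_def is_svd_def)
    ultimately have "q / 2 \<le> \<beta> i" using half[OF m(2)] qM pos by (simp add: q_def)
    then have "(q / 2)\<^sup>2 \<le> (\<beta> i)\<^sup>2" using pq by (intro power_mono) auto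
    then show ?thesis using m \<tau> by (simp add: q_def power_divide)
  qed
  define I where "I = {1..CARD('m)} \<times> {1..CARD('n)}"
  define e where "e = (\<lambda>(i, l). outer (a i) (b l))"
  define \<mu> where "\<mu> = (\<lambda>(i, l). (\<alpha> i)\<^sup>2 + (\<beta> l)\<^sup>2)"
  define RX where "RX = {i \<in> {k<..CARD('m)}. (\<alpha> i)\<^sup>2 < \<tau>}"
  define RY where "RY = {l \<in> {k<..CARD('n)}. (\<beta> l)\<^sup>2 < \<tau>}"
  \<comment> \<open>The pairs below the threshold form a staircase; enlarging it to a rectangle costs nothing
     because both singular values of such a pair are already below \<open>sqrt \<tau>\<close>.\<close>
  have bad: "{x \<in> I. \<mu> x < \<tau>} \<subseteq> RX \<times> RY"
  proof safe
    fix i l assume il: "(i, l) \<in> I" "\<mu> (i, l) < \<tau>"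
    have "(\<alpha> i)\<^sup>2 + (\<beta> l)\<^sup>2 < \<tau>" using il(2) by (simp add: \<mu>_def)
    then have "(\<alpha> i)\<^sup>2 < \<tau>" "(\<beta> l)\<^sup>2 < \<tau>"
      using zero_le_power2[of "\<alpha> i"] zero_le_power2[of "\<beta> l"] by linarith+
    moreover from this have "k < i" "k < l"
      using lead\<alpha>[of i] lead\<beta>[of l] il(1) by (force simp: I_def)+
    ultimately show "i \<in> RX" "l \<in> RY" using il(1) by (auto simp: RX_def RY_def I_def)
  qed
  have "\<exists>j\<in>{1..min DIM((real^'r^'m) \<times> (real^'r^'n)) DIM(real^'n^'m)}. \<tau> \<le> (S j)\<^sup>2 \<and>
      (norm (W - orthogonal_proj (span (U ` {1..j})) W))\<^sup>2 = (\<Sum>x\<in>{x \<in> I. \<mu> x < \<tau>}. (e x \<bullet> W)\<^sup>2)"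
  proof (rule svd_truncation_residual[OF D])
    show "frechet_derivative F_asym (at (X, Y)) (adjoint (frechet_derivative F_asym (at (X, Y))) (e x))
        = \<mu> x *\<^sub>R e x" if xI: "x \<in> I" for x
    proof -
      obtain i l where x: "x = (i, l)" "i \<in> {1..DIM(real^'m)}" "l \<in> {1..DIM(real^'n)}"
        using xI by (auto simp: I_def)
      have "X *v (a i v* X) = (\<alpha> i)\<^sup>2 *\<^sub>R a i" "Y *v (b l v* Y) = (\<beta> l)\<^sup>2 *\<^sub>R b l"
        using svd_gram[OF A \<alpha>0 x(2)] svd_gram[OF B \<beta>0 x(3)] by (simp_all add: adjoint_matrix_vector_mult)
      from F_asym_derivative_eigen[OF this] show ?thesis by (simp add: e_def \<mu>_def x(1))
    qed
    show "(norm M)\<^sup>2 = (\<Sum>x\<in>I. (e x \<bullet> M)\<^sup>2)" for M :: "real^'n^'m"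
      using norm_sq_outer_basis[OF a b, of M] by (simp add: I_def e_def case_prod_unfold)
    show "(1, 1) \<in> I" by (simp add: I_def Suc_leI)
    show "\<tau> \<le> \<mu> (1, 1)" using lead\<alpha>[of 1] k by (simp add: \<mu>_def add_increasing2)
    have "outer (a 1) (b 1) \<bullet> outer (a 1) (b 1) = (a 1 \<bullet> a 1) * (b 1 \<bullet> b 1)"
      by (simp add: outer_def inner_vec_def sum_product mult_ac)
    also have "\<dots> = 1" using a b by (simp add: orthonormal_on_def Suc_leI)
    finally show "e (1, 1) \<noteq> 0" by (auto simp: e_def)
  qed (use pos in \<open>auto simp: I_def\<close>)
  then obtain j where j: "j \<in> {1..min DIM((real^'r^'m) \<times> (real^'r^'n)) DIM(real^'n^'m)}" "\<tau> \<le> (S j)\<^sup>2"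
    and res: "(norm (W - orthogonal_proj (span (U ` {1..j})) W))\<^sup>2 = (\<Sum>x\<in>{x \<in> I. \<mu> x < \<tau>}. (e x \<bullet> W)\<^sup>2)"
    by blast
  define Zs where "Zs = Xs ** transpose Ys"
  have entry: "\<bar>outer (a i) (b l) \<bullet> W\<bar> \<le> \<alpha> i * \<beta> l +
      (q / 7 * \<alpha> i + norm (a i v* W)) * (p / 7 * \<beta> l + norm (W *v b l)) / (p * q)"
    if "i \<in> RX" "l \<in> RY" for i l
  proof -
    have i: "i \<in> {k<..DIM(real^'m)}" "i \<in> {1..DIM(real^'m)}"
      and l: "l \<in> {k<..DIM(real^'n)}" "l \<in> {1..DIM(real^'n)}"
      using that by (auto simp: RX_def RY_def)
    have "\<bar>a i \<bullet> ((X ** transpose Y) *v b l)\<bar> = \<bar>(a i v* X) \<bullet> (b l v* Y)\<bar>"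
      by (simp add: dot_lmul_matrix matrix_vector_mul_assoc[symmetric])
    also have "\<dots> \<le> norm (a i v* X) * norm (b l v* Y)" by (rule Cauchy_Schwarz_ineq2)
    also have "\<dots> = \<alpha> i * \<beta> l"
      using svd_norm_adjoint[OF A \<alpha>0 i(2)] svd_norm_adjoint[OF B \<beta>0 l(2)]
      by (simp add: adjoint_matrix_vector_mult)
    finally have Z: "\<bar>a i \<bullet> ((X ** transpose Y) *v b l)\<bar> \<le> \<alpha> i * \<beta> l" .
    have "norm (Y *v (a i v* X)) \<le> q / 7 * \<alpha> i"
      using matched_trailing_bound[OF SX SY dimk zX zY A \<alpha>0 dX dY matrix_vector_mul_linear M(2) pM[unfolded p_def] _ pos(1,2) i(1)]
        \<epsilon> mpq by (simp add: p_def q_def adjoint_matrix_vector_mult)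
    moreover have "Ys *v (a i v* Xs) = Y *v (a i v* X) - a i v* W"
    proof -
      have "c v* (P ** transpose Q) = Q *v (c v* P)" for c :: "real^'m" and P :: "real^'r^'m" and Q :: "real^'r^'n"
        by (simp add: vector_matrix_mul_assoc[symmetric])
      then show ?thesis by (simp add: W vector_matrix_mult_diff_rdistrib)
    qed
    ultimately have left: "norm (Ys *v (a i v* Xs)) \<le> q / 7 * \<alpha> i + norm (a i v* W)"
      using norm_triangle_ineq4[of "Y *v (a i v* X)" "a i v* W"] by simp
    have "norm (X *v (b l v* Y)) \<le> p / 7 * \<beta> l"
      using matched_trailing_bound[OF SY SX dimk(1,3,2) zY zX B \<beta>0 dY dX matrix_vector_mul_linear M(1) qM[unfolded q_def] _ pos(2,1) l(1)]
        \<epsilon> mpq by (simp add: p_def q_def adjoint_matrix_vector_mult mult.commute)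
    moreover have "Xs *v (b l v* Ys) = X *v (b l v* Y) - W *v b l"
      by (simp add: W matrix_vector_mult_diff_rdistrib matrix_vector_mul_assoc[symmetric])
    ultimately have right: "norm (Xs *v (b l v* Ys)) \<le> p / 7 * \<beta> l + norm (W *v b l)"
      using norm_triangle_ineq4[of "X *v (b l v* Y)" "W *v b l"] by simp
    have "a i \<bullet> (Zs *v b l) = (a i v* Xs) \<bullet> (b l v* Ys)"
      by (simp add: Zs_def dot_lmul_matrix matrix_vector_mul_assoc[symmetric])
    then have "p * q * \<bar>a i \<bullet> (Zs *v b l)\<bar> \<le> norm (Ys *v (a i v* Xs)) * norm (Xs *v (b l v* Ys))"
      using matched_bilinear_bound[OF SX SY dimk zX zY, of "a i" "b l"]
      by (simp add: p_def q_def adjoint_matrix_vector_mult)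
    also have "\<dots> \<le> (q / 7 * \<alpha> i + norm (a i v* W)) * (p / 7 * \<beta> l + norm (W *v b l))"
      using left right by (intro mult_mono) (auto intro: order_trans[OF norm_ge_zero])
    finally have Zs: "\<bar>a i \<bullet> (Zs *v b l)\<bar>
        \<le> (q / 7 * \<alpha> i + norm (a i v* W)) * (p / 7 * \<beta> l + norm (W *v b l)) / (p * q)"
      using pq by (simp add: pos_le_divide_eq mult.commute)
    have "outer (a i) (b l) \<bullet> W = a i \<bullet> ((X ** transpose Y) *v b l) - a i \<bullet> (Zs *v b l)"
      by (simp only: inner_outer W Zs_def matrix_vector_mult_diff_rdistrib inner_diff_right)
    then show ?thesis using Z Zs by linarith
  qed
  have "(\<Sum>x\<in>{x \<in> I. \<mu> x < \<tau>}. (e x \<bullet> W)\<^sup>2) \<le> (\<Sum>x\<in>RX \<times> RY. (e x \<bullet> W)\<^sup>2)"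
    by (rule sum_mono2[OF _ bad]) (auto simp: RX_def RY_def)
  also have "\<dots> = (\<Sum>i\<in>RX. \<Sum>l\<in>RY. (outer (a i) (b l) \<bullet> W)\<^sup>2)"
    by (simp add: sum.cartesian_product e_def case_prod_unfold)
  also have "\<dots> \<le> (\<rho> * norm W)\<^sup>2"
  proof (rule trailing_block_bound[where f = "\<lambda>i. norm (a i v* W)" and g = "\<lambda>l. norm (W *v b l)"
        and \<alpha> = \<alpha> and \<beta> = \<beta> and T = "(real CARD('r) - real k) * \<tau>" and p = p and q = q and m = m])
    show "(\<Sum>i\<in>RX. (\<alpha> i)\<^sup>2) \<le> (real CARD('r) - real k) * \<tau>"
      unfolding RX_def using \<alpha>0 pos k by (intro sum_small_squares_le) auto
    show "(\<Sum>l\<in>RY. (\<beta> l)\<^sup>2) \<le> (real CARD('r) - real k) * \<tau>"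
      unfolding RY_def using \<beta>0 pos k by (intro sum_small_squares_le) auto
    show "(\<Sum>i\<in>RX. (norm (a i v* W))\<^sup>2) \<le> (norm W)\<^sup>2"
      unfolding norm_sq_matrix_rows[OF a, of W] by (rule sum_mono2) (auto simp: RX_def)
    show "(\<Sum>l\<in>RY. (norm (W *v b l))\<^sup>2) \<le> (norm W)\<^sup>2"
      unfolding norm_sq_matrix_columns[OF b, of W] by (rule sum_mono2) (auto simp: RY_def)
    show "0 \<le> (real CARD('r) - real k) * \<tau>" using pos k by simp
  qed (use pos pq m w \<tau> entry in \<open>auto simp: p_def q_def\<close>)
  finally have "(norm (W - orthogonal_proj (span (U ` {1..j})) W))\<^sup>2 \<le> (\<rho> * norm W)\<^sup>2"
    using res by simp
  then have "norm (W - orthogonal_proj (span (U ` {1..j})) W) \<le> \<rho> * norm W"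
    by (rule power2_le_imp_le) (use pos in simp)
  then show ?thesis using j by blast
qed

text \<open>Continuing the singular values by 0 past the index range makes \<open>\<sigma>' i = 0\<close> hold for all \<open>i\<close> beyond
  the rank, inside the range or not.\<close>

lemma svd_of_rank:
  fixes A :: "real^'n^'m"
  assumes A: "is_svd ((*v) A) \<sigma> u v" and k: "rank A = k" "1 \<le> k"
  obtains \<sigma>' where "is_svd ((*v) A) \<sigma>' u v" "k \<le> min CARD('n) CARD('m)" "0 < \<sigma>' k"
    "\<forall>i>k. \<sigma>' i = 0" "\<forall>i\<in>{1..k}. singular_value ((*v) A) i = \<sigma>' i"
proof
  let ?s = "\<lambda>i. if i \<le> min DIM(real^'n) DIM(real^'m) then \<sigma> i else 0"
  show A': "is_svd ((*v) A) ?s u v" by (rule is_svd_restrict[OF A])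
  have r: "dim (range ((*v) A)) = k" using k(1) by (simp add: rank_dim_range)
  note sr = svd_rank[OF A' r k(2)]
  show km: "k \<le> min CARD('n) CARD('m)" using sr(1) unfolding DIM_real_vec .
  show "0 < ?s k" by (rule sr(2))
  show "\<forall>i>k. ?s i = 0"
    using sr(3) by auto
  show "\<forall>i\<in>{1..k}. singular_value ((*v) A) i = ?s i"
    by (intro ballI singular_value_eq[OF A']) (use sr(1) in auto)
qed

theorem theorem5p6:
  shows "(\<forall>(X :: real^'r^'d1) (Y :: real^'r^'d2) X' Y'.
      onorm (\<lambda>H. frechet_derivative F_asym (at (X, Y)) H - frechet_derivative F_asym (at (X', Y')) H)
        \<le> sqrt 2 * norm ((X, Y) - (X', Y'))) \<and>
    (\<forall>(Zs :: real^'d2^'d1) (Xs :: real^'r^'d1) (Ys :: real^'r^'d2) (rs :: nat)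
        (\<sigma> :: (real^'r^'d1) \<times> (real^'r^'d2) \<Rightarrow> nat \<Rightarrow> real) u v.
      rank Zs = rs \<longrightarrow> rs \<ge> 1 \<longrightarrow>
      Zs = Xs ** transpose Ys \<longrightarrow>
      rank Xs = rs \<longrightarrow> rank Ys = rs \<longrightarrow>
      matching_right_singular_vectors Xs Ys \<longrightarrow>
      (\<forall>x. is_svd (frechet_derivative F_asym (at x)) (\<sigma> x) (u x) (v x)) \<longrightarrow>
      (let sX = singular_value ((*v) Xs);
           sY = singular_value ((*v) Ys);
           m = min ((sX rs)\<^sup>2) ((sY rs)\<^sup>2);
           s = (\<lambda>\<rho>. \<rho> / (10 * sqrt 2 * (real CARD('r) - real rs + 1)\<^sup>2)
                      * (m / ((sX rs)\<^sup>2 + (sY rs)\<^sup>2)));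
           \<delta> = (\<lambda>\<rho>. min (\<rho> / 4) (1 / (4 * s \<rho>)) * m);
           \<epsilon> = 1 / (16 * sqrt 2) * (m / max (sX 1) (sY 1))
       in locally_weakly_aligned F_asym \<sigma> u (Xs, Ys) \<delta> s \<epsilon>))"
proof (intro conjI allI impI)
  fix X X' :: "real^'r^'d1" and Y Y' :: "real^'r^'d2"
  have "norm ((X, Y) - (X', Y')) \<le> sqrt 2 * norm ((X, Y) - (X', Y'))"
    by (simp add: mult_le_cancel_right1)
  then show "onorm (\<lambda>H. frechet_derivative F_asym (at (X, Y)) H - frechet_derivative F_asym (at (X', Y')) H)
      \<le> sqrt 2 * norm ((X, Y) - (X', Y'))"
    using onorm_frechet_derivative_F_asym_diff by (rule order_trans[rotated])
next
  fix Zs :: "real^'d2^'d1" and Xs :: "real^'r^'d1" and Ys :: "real^'r^'d2" and rs :: nat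
    and \<sigma> :: "(real^'r^'d1) \<times> (real^'r^'d2) \<Rightarrow> nat \<Rightarrow> real" and u v
  assume rs: "rs \<ge> 1" and rX: "rank Xs = rs" and rY: "rank Ys = rs"
    and match: "matching_right_singular_vectors Xs Ys"
    and D: "\<forall>x. is_svd (frechet_derivative F_asym (at x)) (\<sigma> x) (u x) (v x)"
  from match obtain \<sigma>X0 uX \<sigma>Y0 uY y
    where SX0: "is_svd ((*v) Xs) \<sigma>X0 uX y" and SY0: "is_svd ((*v) Ys) \<sigma>Y0 uY y"
    unfolding matching_right_singular_vectors_def by blast
  obtain \<sigma>X
    where SX: "is_svd ((*v) Xs) \<sigma>X uX y" and kX: "rs \<le> min CARD('r) CARD('d1)" and pX: "0 < \<sigma>X rs"
      and zX': "\<forall>i>rs. \<sigma>X i = 0"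
      and eX: "\<forall>i\<in>{1..rs}. singular_value ((*v) Xs) i = \<sigma>X i"
    using svd_of_rank[OF SX0 rX rs] by blast
  obtain \<sigma>Y
    where SY: "is_svd ((*v) Ys) \<sigma>Y uY y" and kY: "rs \<le> min CARD('r) CARD('d2)" and pY: "0 < \<sigma>Y rs"
      and zY': "\<forall>i>rs. \<sigma>Y i = 0"
      and eY: "\<forall>i\<in>{1..rs}. singular_value ((*v) Ys) i = \<sigma>Y i"
    using svd_of_rank[OF SY0 rY rs] by blast
  note zX = zX'[rule_format] and zY = zY'[rule_format]
  define m where "m = min ((\<sigma>X rs)\<^sup>2) ((\<sigma>Y rs)\<^sup>2)"
  define M where "M = max (\<sigma>X 1) (\<sigma>Y 1)"
  define n where "n = real CARD('r) - real rs"
  define s where "s \<rho> = \<rho> / (10 * sqrt 2 * (n + 1)\<^sup>2) * (m / ((\<sigma>X rs)\<^sup>2 + (\<sigma>Y rs)\<^sup>2))" for \<rho> :: real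
  define \<delta> where "\<delta> \<rho> = min (\<rho> / 4) (1 / (4 * s \<rho>)) * m" for \<rho>
  define \<epsilon> where "\<epsilon> = 1 / (16 * sqrt 2) * (m / M)"
  have m0: "0 < m" using pX pY by (simp add: m_def)
  have mle: "m \<le> (\<sigma>X rs)\<^sup>2" "m \<le> (\<sigma>Y rs)\<^sup>2" by (auto simp: m_def)
  have "\<sigma>X rs \<le> \<sigma>X 1"
    by (rule svd_mono[OF SX order_refl rs]) (use kX in \<open>simp add: DIM_real_vec\<close>)
  then have M0: "0 < M" using pX by (simp add: M_def)
  have n0: "0 \<le> n" using kX by (simp add: n_def)
  have sq2: "14 / 10 \<le> sqrt 2" by (rule real_le_rsqrt) (simp add: power2_eq_square)
  have s0: "0 < s \<rho>" if "0 < \<rho>" for \<rho>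
    using that m0 n0 pX pY unfolding s_def by (intro mult_pos_pos divide_pos_pos add_pos_pos) auto
  have \<delta>0: "0 < \<delta> \<rho>" if "0 < \<rho>" for \<rho>
    using that s0[OF that] m0 by (simp add: \<delta>_def)
  have \<epsilon>0: "0 < \<epsilon>" using m0 M0 by (simp add: \<epsilon>_def)
  \<comment> \<open>The constant 22 is a rational lower bound for \<open>16 * sqrt 2\<close>.\<close>
  have \<epsilon>M: "22 * M * \<epsilon> \<le> m"
  proof -
    have "22 * M * \<epsilon> = 22 / (16 * sqrt 2) * m" using M0 by (simp add: \<epsilon>_def)
    also have "\<dots> \<le> 1 * m" using sq2 m0 by (intro mult_right_mono) (auto simp: divide_le_eq)
    finally show ?thesis by simp
  qed
  have ns: "n * s \<rho> \<le> \<rho> / 28" if \<rho>: "0 < \<rho>" for \<rho>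
  proof -
    have "n \<le> (n + 1)\<^sup>2" using n0 by (simp add: power2_eq_square algebra_simps)
    then have 1: "n / (n + 1)\<^sup>2 \<le> 1" using n0 by (simp add: divide_le_eq)
    have 2: "m / ((\<sigma>X rs)\<^sup>2 + (\<sigma>Y rs)\<^sup>2) \<le> 1 / 2"
      using mle m0 by (simp add: divide_le_eq)
    have "10 * (14 / 10) \<le> 10 * sqrt 2" using sq2 by simp
    then have 3: "\<rho> / (10 * sqrt 2) \<le> \<rho> / 14" using \<rho> by (intro divide_left_mono) auto
    have "n * s \<rho> = \<rho> / (10 * sqrt 2) * (n / (n + 1)\<^sup>2) * (m / ((\<sigma>X rs)\<^sup>2 + (\<sigma>Y rs)\<^sup>2))"
      by (simp add: s_def)
    also have "\<dots> \<le> \<rho> / 14 * 1 * (1 / 2)"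
      using 1 2 3 \<rho> n0 m0 by (intro mult_mono mult_nonneg_nonneg divide_nonneg_nonneg add_nonneg_nonneg) auto
    finally show ?thesis by simp
  qed
  have "locally_weakly_aligned F_asym \<sigma> u (Xs, Ys) \<delta> s \<epsilon>"
    unfolding locally_weakly_aligned_def
  proof (intro conjI allI impI ballI \<epsilon>0 \<delta>0 s0)
    fix \<rho> :: real and x :: "(real^'r^'d1) \<times> (real^'r^'d2)"
    assume \<rho>: "0 < \<rho>" and x: "x \<in> cball (Xs, Ys) \<epsilon>" and z: "F_asym x \<in> cball (F_asym (Xs, Ys)) (\<delta> \<rho>)"
    obtain X Y where XY: "x = (X, Y)" by (cases x)
    define W where "W = F_asym x - F_asym (Xs, Ys)"
    have W: "W = X ** transpose Y - Xs ** transpose Ys" by (simp add: W_def XY F_asym_def)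
    have dist: "norm ((X, Y) - (Xs, Ys)) \<le> \<epsilon>" using x by (simp only: XY mem_cball dist_norm norm_minus_commute)
    then have dX: "norm (X - Xs) \<le> \<epsilon>" and dY: "norm (Y - Ys) \<le> \<epsilon>"
      using norm_fst_le[of "X - Xs" "Y - Ys"] norm_snd_le[of "Y - Ys" "X - Xs"] by auto
    have "norm W \<le> \<delta> \<rho>" using z by (simp add: W_def dist_norm norm_minus_commute)
    moreover have "\<delta> \<rho> \<le> \<rho> / 4 * m" "\<delta> \<rho> \<le> 1 / (4 * s \<rho>) * m"
      unfolding \<delta>_def using m0 by (intro mult_right_mono; simp)+
    ultimately have w: "norm W \<le> \<rho> / 4 * m" "norm W \<le> 1 / (4 * s \<rho>) * m" by linarith+
    show "\<exists>j\<in>{1..min DIM((real^'r^'d1) \<times> (real^'r^'d2)) DIM(real^'d2^'d1)}.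
        norm (F_asym x - F_asym (Xs, Ys) - orthogonal_proj (span (u x ` {1..j})) (F_asym x - F_asym (Xs, Ys)))
          \<le> \<rho> * norm (F_asym x - F_asym (Xs, Ys)) \<and>
        s \<rho> * norm (F_asym x - F_asym (Xs, Ys)) \<le> (\<sigma> x j)\<^sup>2"
      unfolding W_def[symmetric]
    \<comment> \<open>For \<open>W = 0\<close> the threshold \<open>s \<rho> * norm W\<close> is 0 and cuts off nothing, but any index will do.\<close>
    proof (cases "W = 0")
      case True
      have "orthogonal_proj S (0 :: real^'d2^'d1) = 0" if "subspace S" for S
        unfolding orthogonal_proj_def
      proof (rule the_equality)
        show "0 \<in> S \<and> (\<forall>y\<in>S. orthogonal (0 - 0) y)" using that by (auto simp: subspace_0 orthogonal_def)
        fix p assume "p \<in> S \<and> (\<forall>y\<in>S. orthogonal (0 - p) y)"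
        then show "p = 0" by (auto simp: orthogonal_def)
      qed
      then show "\<exists>j\<in>{1..min DIM((real^'r^'d1) \<times> (real^'r^'d2)) DIM(real^'d2^'d1)}.
          norm (W - orthogonal_proj (span (u x ` {1..j})) W) \<le> \<rho> * norm W \<and> s \<rho> * norm W \<le> (\<sigma> x j)\<^sup>2"
        using True by (intro bexI[of _ 1]) (auto simp: Suc_leI)
    next
      case False
      have "\<exists>j\<in>{1..min DIM((real^'r^'d1) \<times> (real^'r^'d2)) DIM(real^'d2^'d1)}.
          s \<rho> * norm W \<le> (\<sigma> x j)\<^sup>2 \<and>
          norm (W - orthogonal_proj (span (u x ` {1..j})) W) \<le> \<rho> * norm W"
      proof (rule F_asym_alignment_at[OF SX SY rs kX kY zX zY pX pY m0 _ \<rho> mle _ _ \<epsilon>M dX dY _ W w(1)])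
        show "0 < s \<rho> * norm W" using s0[OF \<rho>] False by simp
        show "\<sigma>X 1 \<le> M" "\<sigma>Y 1 \<le> M" by (auto simp: M_def)
        show "is_svd (frechet_derivative F_asym (at (X, Y))) (\<sigma> x) (u x) (v x)" using D by (simp add: XY)
        show "s \<rho> * norm W \<le> m / 4" using w(2) s0[OF \<rho>] by (simp add: field_simps)
        show "(real CARD('r) - real rs) * (s \<rho> * norm W) \<le> \<rho> * norm W / 28"
          using mult_right_mono[OF ns[OF \<rho>] norm_ge_zero[of W]] by (simp add: n_def mult.assoc)
      qed
      then show "\<exists>j\<in>{1..min DIM((real^'r^'d1) \<times> (real^'r^'d2)) DIM(real^'d2^'d1)}.
          norm (W - orthogonal_proj (span (u x ` {1..j})) W) \<le> \<rho> * norm W \<and> s \<rho> * norm W \<le> (\<sigma> x j)\<^sup>2"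
        by blast
    qed
  qed
  moreover have "singular_value ((*v) Xs) rs = \<sigma>X rs" "singular_value ((*v) Xs) 1 = \<sigma>X 1"
    "singular_value ((*v) Ys) rs = \<sigma>Y rs" "singular_value ((*v) Ys) 1 = \<sigma>Y 1"
    using eX eY rs by auto
  ultimately show "let sX = singular_value ((*v) Xs);
           sY = singular_value ((*v) Ys);
           m = min ((sX rs)\<^sup>2) ((sY rs)\<^sup>2);
           s = (\<lambda>\<rho>. \<rho> / (10 * sqrt 2 * (real CARD('r) - real rs + 1)\<^sup>2)
                      * (m / ((sX rs)\<^sup>2 + (sY rs)\<^sup>2)));
           \<delta> = (\<lambda>\<rho>. min (\<rho> / 4) (1 / (4 * s \<rho>)) * m);
           \<epsilon> = 1 / (16 * sqrt 2) * (m / max (sX 1) (sY 1))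
       in locally_weakly_aligned F_asym \<sigma> u (Xs, Ys) \<delta> s \<epsilon>"
    unfolding Let_def \<delta>_def[abs_def] s_def[abs_def] \<epsilon>_def m_def M_def n_def by simp
qed

end
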